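(* Let $k\ge 2$ and $d\ge 1$ be integers, let $0<\theta<1$ be real with $d\theta>1$, and let $p\in(1,\infty)$ be determined by $d\theta=d^{1/p}$. Suppose that $(x_i)_{i=1}^\infty$ is a normalized block sequence in $T(\mathcal A_d^k,\theta)$ and that there is a sequence $(v_i)_{i=1}^\infty\subset\omega^{\not\downarrow k}$ such that: (1) $v_1\le x_1<v_2\le x_2<v_3\le x_3<\cdots$; (2) $\mathrm{supp}(x_i)\subset X_{v_i}^{\max}$ and $v_{i+1}\in X_{v_i}^{\max}$ for every $i\ge1$. Then $(x_i)$ is equivalent to the canonical basis of $\ell_p$.
   Context: Sequences and orders. $\omega=\{0,1,2,\dots\}$. For an integer $k\ge1$, $\omega^{\not\downarrow\le k}$ is the set of all non-decreasing finite sequences of elements of $\omega$ of length at most $k$ (including the empty sequence $()$), and $\omega^{\not\downarrow k}$ is the set of those of length exactly $k$. Write $s\sqsubset t$ if $s$ is a proper initial segment of $t$. Let $<_{\mathrm{lex}}$ be the lexicographic order in which a proper initial segment precedes the longer sequence. The well-order $\prec$ (of order type $\omega$) on $\omega^{\not\downarrow\le k}$ is: $()\prec s$ for all nonempty $s$; and for nonempty sequences, $(s_1,\dots,s_i)\prec(t_1,\dots,t_j)$ iff $s_i<t_j$, or $s_i=t_j$ and $(s_1,\dots,s_i)<_{\mathrm{lex}}(t_1,\dots,t_j)$. The spaces $\mathcal E_k$. An $\mathcal E_k$-tree is a function $\widehat X:\omega^{\not\downarrow\le k}\to\omega^{\not\downarrow\le k}$ preserving $\prec$ and $\sqsubset$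 (hence preserving lengths). $\mathcal E_k$ is the collection of all sets $X=\widehat X[\omega^{\not\downarrow k}]$, for $\widehat X$ an $\mathcal E_k$-tree. For $X\in\mathcal E_k$ and $n\ge1$, $r_n(X)$ is the set of the $\prec$-least $n$ elements of $X$; $\mathcal{AR}^k_n=\{r_n(X):X\in\mathcal E_k\}$, $\mathcal{AR}^k=\bigcup_{n\ge1}\mathcal{AR}^k_n$ and $\mathcal A_d^k=\bigcup_{i=1}^d\mathcal{AR}_i^k$. The sets $X_v^{\max}$. For $v=(n_1,\dots,n_k)\in\omega^{\not\downarrow k}$ put $f_j(0)=n_j$ and $f_j(m)=n_k+m$ for $m\ge1$, $1\le j\le k$. The map $\widehat X_v(m_1,\dots,m_l)=(f_1(m_1),\dots,f_l(m_l))$ is an $\mathcal E_k$-tree, and $X_v^{\max}=\widehat X_v[\omega^{\not\downarrow k}]\in\mathcal E_k$. The Banach space $T(\mathcal A_d^k,\theta)$. For nonempty finite $E,F\subset\omega^{\not\downarrow k}$, $E<F$ (resp. $E\le F$) means $\max_\prec E\prec\min_\prec F$ (resp. $\preceq$); an element $v$ is treated as $\{v\}$ and a finitely supported vector as its support. For $1\le m\le d$, a sequence $(E_i)_{i=1}^m$ in $\mathcal{AR}^k$ is $\mathcal A_d^k$-admissible if there is $\{v_1,\dots,v_m\}\in\mathcal A_d^k$ with $v_1\le E_1<v_2\le E_2<\cdots<v_m\le E_m$. On the space $c_{00}(\omega^{\not\downarrow k})$ of finitely supported functions $x:\omega^{\not\downarrow k}\to\mathbb R$, with canonical basis $(e_v)$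 and $Ex=\sum_{v\in E}x_ve_v$, put $|x|_0=\max_v|x_v|$, $|x|_{j+1}=\max\{|x|_j,\ \theta\max\{\sum_{i=1}^m|E_ix|_j:1\le m\le d,\ (E_i)_{i=1}^m\ \mathcal A_d^k\text{-admissible}\}\}$, and $\|x\|=\sup_j|x|_j$. $T(\mathcal A_d^k,\theta)$ is the completion of $c_{00}(\omega^{\not\downarrow k})$ in this norm. A block sequence is a sequence of nonzero finitely supported vectors with $x_1<x_2<\cdots$; normalized means all norms equal $1$. *)

theory Defs
  imports Complex_Main "HOL-Library.Sublist"
begin

section \<open>Non-decreasing sequences and the well-order\<close>

definition omega_le :: "nat \<Rightarrow> nat list set" where
  "omega_le k = {s. sorted s \<and> length s \<le> k}"

definition omega_eq :: "nat \<Rightarrow> nat list set" where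
  "omega_eq k = {s. sorted s \<and> length s = k}"

text \<open>In \<^const>\<open>lexord\<close> a proper initial segment precedes the longer sequence.\<close>

definition prec :: "nat list \<Rightarrow> nat list \<Rightarrow> bool" (infix "\<prec>" 50) where
  "s \<prec> t \<longleftrightarrow> t \<noteq> [] \<and>
     (s = [] \<or> last s < last t \<or> (last s = last t \<and> (s, t) \<in> lexord less_than))"

definition prec_eq :: "nat list \<Rightarrow> nat list \<Rightarrow> bool" (infix "\<preceq>" 50) where
  "s \<preceq> t \<longleftrightarrow> s \<prec> t \<or> s = t"

section \<open>The spaces \<open>\<E>\<^sub>k\<close> and their approximations\<close>

definition is_E_tree :: "nat \<Rightarrow> (nat list \<Rightarrow> nat list) \<Rightarrow> bool" where
  "is_E_tree k h \<longleftrightarrow>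
     (\<forall>s \<in> omega_le k. h s \<in> omega_le k) \<and>
     (\<forall>s \<in> omega_le k. \<forall>t \<in> omega_le k. s \<prec> t \<longrightarrow> h s \<prec> h t) \<and>
     (\<forall>s \<in> omega_le k. \<forall>t \<in> omega_le k. strict_prefix s t \<longrightarrow> strict_prefix (h s) (h t))"

definition E_space :: "nat \<Rightarrow> nat list set set" where
  "E_space k = {h ` omega_eq k |h. is_E_tree k h}"

text \<open>The \<open>\<prec>\<close>-least \<open>n\<close> elements of \<open>X\<close> are those with fewer than \<open>n\<close> predecessors in \<open>X\<close>;
  the cardinality is meaningful by the lemma \<open>finite_predecessors\<close> below.\<close>

definition approx :: "nat \<Rightarrow> nat list set \<Rightarrow> nat list set" where
  "approx n X = {s \<in> X. card {t \<in> X. t \<prec> s} < n}"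

lemma finite_predecessors: "finite {t \<in> omega_le k. t \<prec> s}"
proof -
  have "set t \<subseteq> {..last s}" if "t \<in> omega_le k" "t \<prec> s" for t
  proof
    fix a assume a: "a \<in> set t"
    then have "t \<noteq> []" by auto
    with that have "last t \<le> last s" by (auto simp: prec_def)
    moreover have "a \<le> last t"
      using that(1) a \<open>t \<noteq> []\<close>
      by (cases t rule: rev_cases) (auto simp: omega_le_def sorted_append)
    ultimately show "a \<in> {..last s}" by simp
  qed
  then have "{t \<in> omega_le k. t \<prec> s} \<subseteq> {t. set t \<subseteq> {..last s} \<and> length t \<le> k}"
    by (auto simp: omega_le_def)
  then show ?thesis
    by (rule finite_subset) (simp add: finite_lists_length_le)
qed

definition AR_n :: "nat \<Rightarrow> nat \<Rightarrow> nat list set set" where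
  "AR_n k n = {approx n X |X. X \<in> E_space k}"

definition AR :: "nat \<Rightarrow> nat list set set" where
  "AR k = (\<Union>n\<in>{1..}. AR_n k n)"

definition A_family :: "nat \<Rightarrow> nat \<Rightarrow> nat list set set" where
  "A_family k d = (\<Union>i\<in>{1..d}. AR_n k i)"

section \<open>The sets \<open>X\<^sub>v\<^sup>m\<^sup>a\<^sup>x\<close>\<close>

text \<open>\<^const>\<open>zip\<close> pairs the entry \<open>n\<^sub>j\<close> of \<open>v\<close> with the entry \<open>m\<^sub>j\<close> of the argument and truncates
  \<open>v\<close> to the length of the argument; \<open>last v\<close> is \<open>n\<^sub>k\<close>.\<close>

definition max_tree :: "nat list \<Rightarrow> nat list \<Rightarrow> nat list" where
  "max_tree v s = map (\<lambda>(n, m). if m = 0 then n else last v + m) (zip v s)"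

definition X_max :: "nat \<Rightarrow> nat list \<Rightarrow> nat list set" where
  "X_max k v = max_tree v ` omega_eq k"

section \<open>The norm of \<open>T(\<A>\<^sub>d\<^sup>k, \<theta>)\<close>\<close>

definition is_prec_max :: "nat list \<Rightarrow> nat list set \<Rightarrow> bool" where
  "is_prec_max s E \<longleftrightarrow> s \<in> E \<and> (\<forall>t\<in>E. t \<preceq> s)"

definition is_prec_min :: "nat list \<Rightarrow> nat list set \<Rightarrow> bool" where
  "is_prec_min s E \<longleftrightarrow> s \<in> E \<and> (\<forall>t\<in>E. s \<preceq> t)"

definition set_less :: "nat list set \<Rightarrow> nat list set \<Rightarrow> bool" where
  "set_less E F \<longleftrightarrow> (\<exists>s t. is_prec_max s E \<and> is_prec_min t F \<and> s \<prec> t)"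

definition set_le :: "nat list set \<Rightarrow> nat list set \<Rightarrow> bool" where
  "set_le E F \<longleftrightarrow> (\<exists>s t. is_prec_max s E \<and> is_prec_min t F \<and> s \<preceq> t)"

definition admissible :: "nat \<Rightarrow> nat \<Rightarrow> nat \<Rightarrow> (nat \<Rightarrow> nat list set) \<Rightarrow> bool" where
  "admissible k d m E \<longleftrightarrow>
     1 \<le> m \<and> m \<le> d \<and> (\<forall>i\<in>{1..m}. E i \<in> AR k) \<and>
     (\<exists>v. v ` {1..m} \<in> A_family k d \<and>
        (\<forall>i\<in>{1..m}. set_le {v i} (E i)) \<and>
        (\<forall>i\<in>{1..<m}. set_less (E i) {v (Suc i)}))"

definition supp :: "(nat list \<Rightarrow> real) \<Rightarrow> nat list set" where
  "supp x = {v. x v \<noteq> 0}"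

definition c00 :: "nat \<Rightarrow> (nat list \<Rightarrow> real) set" where
  "c00 k = {x. finite (supp x) \<and> supp x \<subseteq> omega_eq k}"

definition proj :: "nat list set \<Rightarrow> (nat list \<Rightarrow> real) \<Rightarrow> nat list \<Rightarrow> real" where
  "proj E x = (\<lambda>v. if v \<in> E then x v else 0)"

text \<open>For \<open>x \<in> c00 k\<close> both maxima range over finite nonempty sets, since \<open>proj E x\<close> depends only on
  \<open>E \<inter> supp x\<close>.\<close>

primrec T_norm_iter :: "nat \<Rightarrow> nat \<Rightarrow> real \<Rightarrow> nat \<Rightarrow> (nat list \<Rightarrow> real) \<Rightarrow> real" where
  "T_norm_iter k d \<theta> 0 = (\<lambda>x. Max ((\<lambda>v. \<bar>x v\<bar>) ` omega_eq k))"
| "T_norm_iter k d \<theta> (Suc j) = (\<lambda>x. max (T_norm_iter k d \<theta> j x)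
     (\<theta> * Max {\<Sum>i=1..m. T_norm_iter k d \<theta> j (proj (E i) x) |m E. admissible k d m E}))"

text \<open>The norm of \<open>T(\<A>\<^sub>d\<^sup>k, \<theta>)\<close> on its dense subspace \<open>c00 k\<close>, which contains all block sequences
  and their finite linear combinations.\<close>

definition T_norm :: "nat \<Rightarrow> nat \<Rightarrow> real \<Rightarrow> (nat list \<Rightarrow> real) \<Rightarrow> real" where
  "T_norm k d \<theta> x = (SUP j. T_norm_iter k d \<theta> j x)"

definition block_sequence :: "nat \<Rightarrow> (nat \<Rightarrow> nat list \<Rightarrow> real) \<Rightarrow> bool" where
  "block_sequence k x \<longleftrightarrow>
     (\<forall>i. x i \<in> c00 k \<and> supp (x i) \<noteq> {}) \<and> (\<forall>i. set_less (supp (x i)) (supp (x (Suc i))))"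

section \<open>Equivalence with the canonical basis of \<open>\<ell>\<^sub>p\<close>\<close>

definition lincomb :: "nat \<Rightarrow> (nat \<Rightarrow> real) \<Rightarrow> (nat \<Rightarrow> 'a \<Rightarrow> real) \<Rightarrow> 'a \<Rightarrow> real" where
  "lincomb n a x = (\<lambda>t. \<Sum>i<n. a i * x i t)"

text \<open>Two sequences of real functions, measured in the norms \<open>M\<close> and \<open>N\<close> respectively, are
  equivalent if their finite linear combinations have uniformly comparable norms.\<close>

definition equivalent_sequences ::
  "(('a \<Rightarrow> real) \<Rightarrow> real) \<Rightarrow> (nat \<Rightarrow> 'a \<Rightarrow> real) \<Rightarrow> (('b \<Rightarrow> real) \<Rightarrow> real) \<Rightarrow> (nat \<Rightarrow> 'b \<Rightarrow> real) \<Rightarrow> bool"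
  where
  "equivalent_sequences M x N y \<longleftrightarrow>
     (\<exists>C>0. \<forall>n a. M (lincomb n a x) \<le> C * N (lincomb n a y) \<and>
                  N (lincomb n a y) \<le> C * M (lincomb n a x))"

definition lp_norm :: "real \<Rightarrow> (nat \<Rightarrow> real) \<Rightarrow> real" where
  "lp_norm p b = (\<Sum>i. \<bar>b i\<bar> powr p) powr (1 / p)"

definition lp_basis :: "nat \<Rightarrow> nat \<Rightarrow> real" where
  "lp_basis i = (\<lambda>j. if j = i then 1 else 0)"

end

theory Submission
  imports Defs "HOL-Library.FuncSet" "HOL-Analysis.Convex"
begin

text \<open>Let \<open>1 / p + 1 / q = 1\<close>, so that \<open>\<theta> powr q = 1 / d\<close>, and let \<open>a\<close> be a coefficient sequence.

  Upper estimate. In the tree of sets that computes the norm of \<open>\<Sum> a i x i\<close>, a block \<open>x i\<close> may be cut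
  by several pieces. A piece meeting only \<open>x i\<close> is absorbed in \<open>\<parallel>x i\<parallel> = 1\<close>, and a piece cutting \<open>x i\<close> has
  it as its first or last block. Hence at each level below the first cut at most two pieces continue to
  cut \<open>x i\<close>, the contributions of \<open>x i\<close> form a geometric series, and the norm is at most a constant times
  \<open>\<Sum> \<bar>a i\<bar> u i\<close>, where \<open>u i = \<theta> ^ n i\<close> for leaves at depths \<open>n i\<close> of a \<open>d\<close>-ary tree. Kraft's
  inequality gives \<open>\<Sum> (u i) powr q \<le> 1\<close>, and Hoelder's inequality concludes.

  Lower estimate. Among blocks whose indices differ by at least 3, any at most \<open>d\<close> successive groups are
  separated by an admissible family. The weights \<open>\<bar>a i\<bar> powr p / \<Sum> \<bar>a j\<bar> powr p\<close> cut \<open>[0, 1)\<close> into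
  successive intervals; choosing in each a \<open>d\<close>-adic interval of comparable length arranges the blocks
  as leaves of a \<open>d\<close>-ary tree whose branchings are admissible.\<close>

section \<open>The order and trees with prescribed last entries\<close>

lemma lexord_less_than_irrefl [simp]: "(s, s) \<notin> lexord less_than"
  by (rule lexord_irreflexive) simp

lemma lexord_less_than_asym: "(s, t) \<in> lexord less_than \<Longrightarrow> (t, s) \<notin> lexord less_than"
  by (rule lexord_asymmetric) (auto intro: asymI)

lemma prec_irrefl [simp]: "\<not> s \<prec> s"
  by (auto simp: prec_def)

lemma prec_trans [trans]:
  assumes "s \<prec> t" "t \<prec> u"
  shows "s \<prec> u"
proof -
  have "trans (lexord less_than)" by (rule lexord_transI) simp
  with assms show ?thesis
    unfolding prec_def by (auto dest: transD)
qed

lemma prec_asym: "s \<prec> t \<Longrightarrow> \<not> t \<prec> s"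
  using prec_trans prec_irrefl by blast

lemma prec_linear: "s \<prec> t \<or> s = t \<or> t \<prec> s"
proof -
  have "(s, t) \<in> lexord less_than \<or> s = t \<or> (t, s) \<in> lexord less_than"
    by (rule lexord_linear) auto
  then show ?thesis
    by (cases "s = []"; cases "t = []") (auto simp: prec_def)
qed

lemma not_prec: "\<not> s \<prec> t \<longleftrightarrow> t \<preceq> s"
  unfolding prec_eq_def using prec_linear prec_asym by blast

lemma prec_eq_refl [simp]: "s \<preceq> s"
  by (simp add: prec_eq_def)

lemma prec_eq_trans [trans]: "s \<preceq> t \<Longrightarrow> t \<preceq> u \<Longrightarrow> s \<preceq> u"
  unfolding prec_eq_def using prec_trans by blast

lemma prec_prec_eq_trans [trans]: "s \<prec> t \<Longrightarrow> t \<preceq> u \<Longrightarrow> s \<prec> u"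
  unfolding prec_eq_def using prec_trans by blast

lemma prec_eq_prec_trans [trans]: "s \<preceq> t \<Longrightarrow> t \<prec> u \<Longrightarrow> s \<prec> u"
  unfolding prec_eq_def using prec_trans by blast

lemma prec_imp_last_le: "s \<prec> t \<Longrightarrow> s \<noteq> [] \<Longrightarrow> last s \<le> last t"
  by (auto simp: prec_def)

lemma strict_prefix_append_ConsE:
  assumes "strict_prefix s t"
  obtains b z where "t = s @ b # z"
proof -
  obtain z where "t = s @ z" "z \<noteq> []"
    using assms by (auto simp: strict_prefix_def prefix_def)
  with that show thesis by (cases z) auto
qed

lemma strict_prefix_imp_lexord: "strict_prefix s t \<Longrightarrow> (s, t) \<in> lexord r"
  by (auto elim!: strict_prefix_append_ConsE intro!: lexord_append_rightI)

lemma last_take_le_last: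
  assumes "sorted s" "0 < n" "s \<noteq> []"
  shows "last (take n s) \<le> last s"
proof -
  have "last (take n s) \<in> set s"
    using assms by (metis in_set_takeD last_in_set less_numeral_extra(3) take_eq_Nil)
  with assms(1) show ?thesis
    by (cases s rule: rev_cases) (auto simp: sorted_append)
qed

lemma strict_prefix_imp_prec:
  assumes "strict_prefix s t" "sorted t"
  shows "s \<prec> t"
proof (cases "s = []")
  case True
  then show ?thesis using assms(1) by (auto simp: prec_def)
next
  case False
  have "t \<noteq> []" using assms(1) by auto
  have s: "s = take (length s) t"
    using assms(1) by (metis append_eq_conv_conj prefix_def strict_prefix_def)
  have "last s \<le> last t"
    using last_take_le_last[of t "length s"] assms(2) False \<open>t \<noteq> []\<close> s by simp
  then show ?thesis
    using strict_prefix_imp_lexord[OF assms(1), of less_than] \<open>t \<noteq> []\<close>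
    by (auto simp: prec_def)
qed

lemma omega_eq_subset_omega_le: "omega_eq k \<subseteq> omega_le k"
  by (auto simp: omega_eq_def omega_le_def)

lemma finite_predecessors_omega_eq: "finite {t \<in> omega_eq k. t \<prec> s}"
  by (rule finite_subset[OF _ finite_predecessors[of k s]]) (use omega_eq_subset_omega_le in auto)

lemma infinite_omega_eq:
  assumes "1 \<le> k"
  shows "infinite (omega_eq k)"
proof -
  have "range (\<lambda>n. replicate k (n::nat)) \<subseteq> omega_eq k"
    by (auto simp: omega_eq_def)
  moreover have "inj (\<lambda>n. replicate k (n::nat))"
    using assms by (auto simp: inj_def)
  ultimately show ?thesis
    by (metis finite_imageD finite_subset infinite_UNIV_nat)
qed

lemma ex_prec_max:
  assumes "finite F" "F \<noteq> {}"
  shows "\<exists>s. is_prec_max s F"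
  using assms
proof (induction F rule: finite_ne_induct)
  case (singleton s)
  then show ?case by (auto simp: is_prec_max_def)
next
  case (insert s F)
  then obtain u where u: "is_prec_max u F" by blast
  show ?case
  proof (cases "s \<prec> u")
    case True
    with u show ?thesis by (intro exI[of _ u]) (auto simp: is_prec_max_def prec_eq_def)
  next
    case False
    then have "u \<preceq> s" by (simp add: not_prec)
    with u show ?thesis
      by (intro exI[of _ s]) (auto simp: is_prec_max_def intro: prec_eq_trans)
  qed
qed

section \<open>Ranks of nodes, and trees built from prescribed last entries\<close>

definition rank :: "nat \<Rightarrow> nat list \<Rightarrow> nat" where
  "rank k s = card {t \<in> omega_eq k. t \<prec> s}"

lemma rank_mono:
  assumes "s \<preceq> t"
  shows "rank k s \<le> rank k t"
  unfolding rank_def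
  by (rule card_mono[OF finite_predecessors_omega_eq]) (use assms in \<open>auto intro: prec_prec_eq_trans\<close>)

lemma rank_strict_mono:
  assumes "s \<in> omega_eq k" "s \<prec> t"
  shows "rank k s < rank k t"
  unfolding rank_def
proof (rule psubset_card_mono[OF finite_predecessors_omega_eq])
  show "{u \<in> omega_eq k. u \<prec> s} \<subset> {u \<in> omega_eq k. u \<prec> t}"
    using assms prec_trans by fastforce
qed

lemma inj_on_rank: "inj_on (rank k) (omega_eq k)"
  by (rule inj_onI) (metis less_irrefl prec_linear rank_strict_mono)

text \<open>Among the leaves of rank at least \<open>n\<close> take one of least rank. Its
  predecessors have ranks below \<open>n\<close>, and since \<open>rank\<close> is injective on
  leaves there are at most \<open>n\<close> of them.\<close>

lemma ex_rank_eq: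
  assumes "1 \<le> k"
  shows "\<exists>s \<in> omega_eq k. rank k s = n"
proof -
  have "infinite (rank k ` omega_eq k)"
    using infinite_omega_eq[OF assms] inj_on_rank finite_imageD by blast
  then have "\<exists>m \<in> rank k ` omega_eq k. n \<le> m"
    by (meson finite_nat_set_iff_bounded linorder_not_less)
  then obtain s where s: "s \<in> omega_eq k" "n \<le> rank k s"
    and least: "\<And>t. t \<in> omega_eq k \<and> n \<le> rank k t \<Longrightarrow> rank k s \<le> rank k t"
    using ex_has_least_nat[of "\<lambda>s. s \<in> omega_eq k \<and> n \<le> rank k s" _ "rank k"] by blast
  have "rank k ` {t \<in> omega_eq k. t \<prec> s} \<subseteq> {..<n}"
    using least rank_strict_mono by (fastforce simp: not_le[symmetric])
  then have "card {t \<in> omega_eq k. t \<prec> s} \<le> n"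
    using card_inj_on_le[of "rank k" "{t \<in> omega_eq k. t \<prec> s}" "{..<n}"]
    by (auto intro: inj_on_subset[OF inj_on_rank])
  with s show ?thesis by (auto simp: rank_def intro!: bexI[of _ s])
qed

text \<open>Equal ranks leave no leaf between \<open>s\<close> and \<open>t\<close>. The leaf
  extending \<open>s\<close> by copies of its last entry does not precede \<open>s\<close>, so it
  cannot precede \<open>t\<close>; this forces equal last entries and excludes a difference at a
  position present in both.\<close>

lemma rank_eq_imp_strict_prefix:
  assumes "s \<in> omega_le k" "t \<in> omega_le k" "s \<prec> t" "s \<noteq> []" "rank k s = rank k t"
  shows "strict_prefix s t"
proof -
  define r where "r = replicate (k - length s) (last s)"
  have sor: "sorted s" and len: "length s \<le> k" using assms(1) by (auto simp: omega_le_def)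
  have "\<forall>a \<in> set s. a \<le> last s"
    using sor by (cases s rule: rev_cases) (auto simp: sorted_append)
  then have full: "s @ r \<in> omega_eq k"
    using sor len by (auto simp: omega_eq_def r_def sorted_append)
  have last: "last (s @ r) = last s"
    using assms(4) by (simp add: r_def last_append)
  have "{u \<in> omega_eq k. u \<prec> s} = {u \<in> omega_eq k. u \<prec> t}"
    using assms(3,5) finite_predecessors_omega_eq[of k t] prec_trans
    unfolding rank_def by (intro card_subset_eq) auto
  moreover have "\<not> s @ r \<prec> s"
    using last assms(4) lexord_append_rightI[of r s less_than] lexord_less_than_asym[of s "s @ r"]
    by (cases "r = []") (auto simp: prec_def neq_Nil_conv)
  ultimately have "\<not> s @ r \<prec> t" using full by auto
  then have le: "t \<preceq> s @ r" by (simp add: not_prec)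
  have "t \<noteq> []" using assms(3) by (auto simp: prec_def)
  have "last t \<le> last s"
    using le last prec_imp_last_le[OF _ \<open>t \<noteq> []\<close>] unfolding prec_eq_def by (metis order_refl)
  with assms(3,4) have last_t: "last t = last s" and lex: "(s, t) \<in> lexord less_than"
    by (auto simp: prec_def)
  from lex consider (pre) b z where "t = s @ b # z"
    | (diff) u a b x y where "a < b" "s = u @ a # x" "t = u @ b # y"
    unfolding lexord_def by auto
  then show ?thesis
  proof cases
    case pre
    then show ?thesis by (auto simp: strict_prefix_def)
  next
    case diff
    then have "(s @ r, t) \<in> lexord less_than" unfolding lexord_def by auto
    then have "s @ r \<prec> t" using last last_t \<open>t \<noteq> []\<close> assms(4) by (auto simp: prec_def)
    with \<open>\<not> s @ r \<prec> t\<close> show ?thesis by simp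
  qed
qed

text \<open>A tree whose leaf of rank \<open>n\<close> has last entry \<open>N n\<close>.\<close>

definition rank_tree :: "nat \<Rightarrow> (nat \<Rightarrow> nat) \<Rightarrow> nat list \<Rightarrow> nat list" where
  "rank_tree k N s = map (\<lambda>j. N (rank k (take (Suc j) s))) [0..<length s]"

lemma length_rank_tree [simp]: "length (rank_tree k N s) = length s"
  by (simp add: rank_tree_def)

lemma last_rank_tree: "s \<noteq> [] \<Longrightarrow> last (rank_tree k N s) = N (rank k s)"
  by (simp add: rank_tree_def last_map)

lemma sorted_rank_tree:
  assumes "sorted s" "mono N"
  shows "sorted (rank_tree k N s)"
proof -
  have "rank k (take (Suc i) s) \<le> rank k (take (Suc j) s)" if "i \<le> j" "j < length s" for i j
  proof (cases "i = j")
    case False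
    have "take (Suc j) s = take (Suc i) s @ take (j - i) (drop (Suc i) s)"
      using take_add[of "Suc i" "j - i" s] \<open>i \<le> j\<close> by simp
    moreover have "take (j - i) (drop (Suc i) s) \<noteq> []" using that False by simp
    ultimately have "strict_prefix (take (Suc i) s) (take (Suc j) s)"
      by (auto simp: strict_prefix_def)
    then have "take (Suc i) s \<prec> take (Suc j) s"
      using assms(1) by (intro strict_prefix_imp_prec) (auto intro: sorted_wrt_take)
    then show ?thesis by (intro rank_mono) (simp add: prec_eq_def)
  qed simp
  then show ?thesis
    using assms(2) by (auto simp: rank_tree_def sorted_iff_nth_mono mono_def)
qed

lemma strict_prefix_rank_tree:
  assumes "strict_prefix s t"
  shows "strict_prefix (rank_tree k N s) (rank_tree k N t)"
proof -
  obtain u where u: "t = s @ u" "u \<noteq> []"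
    using assms by (auto simp: strict_prefix_def prefix_def)
  have "rank_tree k N t = rank_tree k N s @
      map (\<lambda>j. N (rank k (take (Suc j) t))) [length s..<length t]"
    using u upt_add_eq_append[of 0 "length s" "length u"] by (simp add: rank_tree_def)
  moreover have "map (\<lambda>j. N (rank k (take (Suc j) t))) [length s..<length t] \<noteq> []"
    using u by simp
  ultimately show ?thesis by (auto simp: strict_prefix_def)
qed

text \<open>Nonempty nodes of different rank are separated by the last entries of their images.
  Equal ranks occur only between a node and its extension, and prefixes are preserved.\<close>

lemma is_E_tree_rank_tree:
  assumes "strict_mono N"
  shows "is_E_tree k (rank_tree k N)"
  unfolding is_E_tree_def
proof (intro conjI ballI impI)
  fix s assume "s \<in> omega_le k"
  then show "rank_tree k N s \<in> omega_le k"
    using assms by (auto simp: omega_le_def sorted_rank_tree strict_mono_mono)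
next
  fix s t assume s: "s \<in> omega_le k" and t: "t \<in> omega_le k" and prec: "s \<prec> t"
  have "t \<noteq> []" using prec by (auto simp: prec_def)
  have ht: "rank_tree k N t \<noteq> []"
    using \<open>t \<noteq> []\<close> length_rank_tree by (metis length_0_conv)
  show "rank_tree k N s \<prec> rank_tree k N t"
  proof (cases "s = []")
    case True
    with ht show ?thesis by (auto simp: prec_def rank_tree_def)
  next
    case False
    have "rank k s \<le> rank k t" using prec by (intro rank_mono) (simp add: prec_eq_def)
    then consider "rank k s < rank k t" | "rank k s = rank k t" by linarith
    then show ?thesis
    proof cases
      case 1
      then have "N (rank k s) < N (rank k t)" using assms by (simp add: strict_mono_less)
      then show ?thesis
        using ht False \<open>t \<noteq> []\<close> by (auto simp: prec_def last_rank_tree)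
    next
      case 2
      have "strict_prefix s t" by (rule rank_eq_imp_strict_prefix[OF s t prec False 2])
      then show ?thesis
        using t assms
        by (intro strict_prefix_imp_prec strict_prefix_rank_tree sorted_rank_tree)
           (auto simp: omega_le_def strict_mono_mono)
    qed
  qed
next
  fix s t :: "nat list" assume "strict_prefix s t"
  then show "strict_prefix (rank_tree k N s) (rank_tree k N t)" by (rule strict_prefix_rank_tree)
qed

lemma E_tree_prec_iff:
  assumes "is_E_tree k h" "s \<in> omega_le k" "t \<in> omega_le k"
  shows "h s \<prec> h t \<longleftrightarrow> s \<prec> t"
  using assms prec_linear[of s t] prec_asym unfolding is_E_tree_def by (metis prec_irrefl)

text \<open>A tree is an order embedding on leaves, so an image leaf has as many predecessors in the
  image as its source has among the leaves.\<close>

lemma approx_E_tree: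
  assumes h: "is_E_tree k h"
  shows "approx n (h ` omega_eq k) = h ` {s \<in> omega_eq k. rank k s < n}"
proof -
  have inj: "inj_on h (omega_eq k)"
    using h omega_eq_subset_omega_le prec_linear
    unfolding is_E_tree_def inj_on_def by (metis prec_irrefl subsetD)
  have "card {t \<in> h ` omega_eq k. t \<prec> h s} = rank k s" if s: "s \<in> omega_eq k" for s
  proof -
    have "{t \<in> h ` omega_eq k. t \<prec> h s} = h ` {t \<in> omega_eq k. t \<prec> s}"
      using E_tree_prec_iff[OF h] s omega_eq_subset_omega_le by blast
    then show ?thesis
      unfolding rank_def using inj by (simp add: card_image inj_on_def)
  qed
  then show ?thesis unfolding approx_def by auto
qed

text \<open>Supplies the separating points of an admissible sequence: any increasing choice of
  \<open>m\<close> last entries is realised by the first \<open>m\<close> leaves of a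
  \<open>rank_tree\<close>.\<close>

lemma ex_approximation_with_last:
  fixes N :: "nat \<Rightarrow> nat"
  assumes "1 \<le> k" "1 \<le> m" and N: "\<And>i j. 1 \<le> i \<Longrightarrow> i < j \<Longrightarrow> j \<le> m \<Longrightarrow> N i < N j"
  shows "\<exists>u. u ` {1..m} \<in> AR_n k m \<and> (\<forall>l\<in>{1..m}. u l \<in> omega_eq k \<and> last (u l) = N l)"
proof -
  \<comment> \<open>The index is shifted because ranks start at 0 and the family at 1; beyond the
    prescribed values \<open>N'\<close> merely continues to increase.\<close>
  define N' where "N' n = (if n < m then N (Suc n) else N m + n)" for n
  have "N' i < N' j" if "i < j" for i j
  proof -
    have "N (Suc i) \<le> N m" if "i < m"
      using N[of "Suc i" m] that by (cases "Suc i = m") auto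
    then show ?thesis
      using \<open>i < j\<close> assms(2) N[of "Suc i" "Suc j"] unfolding N'_def by fastforce
  qed
  then have N': "strict_mono N'" by (simp add: strict_mono_def)
  obtain e where e: "e n \<in> omega_eq k" "rank k (e n) = n" for n
    using ex_rank_eq[OF assms(1)] by metis
  define u where "u l = rank_tree k N' (e (l - 1))" for l
  have tree: "is_E_tree k (rank_tree k N')" by (rule is_E_tree_rank_tree[OF N'])
  have "{s \<in> omega_eq k. rank k s < m} = e ` {..<m}"
    using e inj_on_rank by (fastforce simp: inj_on_def image_iff)
  moreover have "{..<m} = (\<lambda>l. l - 1) ` {1..m}"
    by (auto simp: image_iff intro!: bexI[of _ "Suc _"])
  ultimately have "u ` {1..m} = approx m (rank_tree k N' ` omega_eq k)"
    using approx_E_tree[OF tree] by (auto simp: u_def image_image)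
  then have "u ` {1..m} \<in> AR_n k m"
    unfolding AR_n_def E_space_def using tree by blast
  moreover have "u l \<in> omega_eq k \<and> last (u l) = N l" if "l \<in> {1..m}" for l
  proof -
    have "e (l - 1) \<noteq> []" using e(1)[of "l - 1"] assms(1) by (auto simp: omega_eq_def)
    then show ?thesis
      using that e N' by (auto simp: u_def last_rank_tree N'_def omega_eq_def sorted_rank_tree strict_mono_mono)
  qed
  ultimately show ?thesis by blast
qed

text \<open>Cutting \<open>X\<close> below \<open>b\<close> gives the approximation whose length is
  the number of elements before \<open>b\<close>; the witness \<open>w\<close> makes this number
  positive, as \<open>AR\<close> requires.\<close>

lemma initial_segment_in_AR:
  assumes "X \<in> E_space k" "w \<in> X" "w \<prec> b"
  shows "{t \<in> X. t \<prec> b} \<in> AR k"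
proof -
  obtain h where h: "is_E_tree k h" "X = h ` omega_eq k"
    using assms(1) by (auto simp: E_space_def)
  then have "X \<subseteq> omega_le k"
    using omega_eq_subset_omega_le by (auto simp: is_E_tree_def)
  then have fin: "finite {t \<in> X. t \<prec> s}" for s
    by (intro finite_subset[OF _ finite_predecessors[of k s]]) auto
  define n where "n = card {t \<in> X. t \<prec> b}"
  have "n \<noteq> 0" using assms(2,3) fin by (auto simp: n_def)
  have "card {t \<in> X. t \<prec> s} < n \<longleftrightarrow> s \<prec> b" if s: "s \<in> X" for s
  proof
    assume "s \<prec> b"
    then have "{t \<in> X. t \<prec> s} \<subset> {t \<in> X. t \<prec> b}" using s prec_trans by fastforce
    then show "card {t \<in> X. t \<prec> s} < n" unfolding n_def by (rule psubset_card_mono[OF fin])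
  next
    assume less: "card {t \<in> X. t \<prec> s} < n"
    show "s \<prec> b"
    proof (rule ccontr)
      assume "\<not> s \<prec> b"
      then have "{t \<in> X. t \<prec> b} \<subseteq> {t \<in> X. t \<prec> s}"
        by (auto simp: not_prec intro: prec_prec_eq_trans)
      then have "n \<le> card {t \<in> X. t \<prec> s}" unfolding n_def by (rule card_mono[OF fin])
      with less show False by simp
    qed
  qed
  then have "approx n X = {t \<in> X. t \<prec> b}" unfolding approx_def by auto
  then show ?thesis
    using \<open>n \<noteq> 0\<close> assms(1) by (auto simp: AR_def AR_n_def intro!: bexI[of _ n])
qed

section \<open>The maximal trees and their composition\<close>

lemma length_max_tree [simp]: "length (max_tree v s) = min (length v) (length s)"
  by (simp add: max_tree_def)

lemma nth_max_tree:
  "i < length v \<Longrightarrow> i < length s \<Longrightarrow>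
    max_tree v s ! i = (if s ! i = 0 then v ! i else last v + s ! i)"
  by (simp add: max_tree_def)

lemma nth_le_last: "sorted s \<Longrightarrow> i < length s \<Longrightarrow> s ! i \<le> last s"
  by (cases "s = []") (auto simp: last_conv_nth sorted_iff_nth_mono)

lemma sorted_max_tree:
  assumes "sorted v" "sorted s"
  shows "sorted (max_tree v s)"
  unfolding sorted_iff_nth_mono
proof (intro allI impI)
  fix i j assume ij: "i \<le> j" "j < length (max_tree v s)"
  then have "s ! i \<le> s ! j" "v ! i \<le> v ! j" "v ! i \<le> last v"
    using assms by (auto simp: sorted_iff_nth_mono nth_le_last)
  then show "max_tree v s ! i \<le> max_tree v s ! j"
    using ij by (auto simp: nth_max_tree)
qed

lemma max_tree_in_omega_eq: "v \<in> omega_eq k \<Longrightarrow> s \<in> omega_eq k \<Longrightarrow> max_tree v s \<in> omega_eq k"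
  by (auto simp: omega_eq_def sorted_max_tree)

lemma last_max_tree:
  assumes "v \<in> omega_eq k" "s \<in> omega_eq k" "1 \<le> k"
  shows "last (max_tree v s) = last v + last s"
proof -
  have "max_tree v s \<noteq> []" "v \<noteq> []" "s \<noteq> []"
    using assms by (auto simp: omega_eq_def max_tree_def)
  then show ?thesis
    using assms by (auto simp: last_conv_nth nth_max_tree omega_eq_def)
qed

text \<open>Last entries add under \<open>max_tree\<close>, so a nonzero entry of \<open>t\<close>
  is raised by \<open>last v + last s\<close> on either side; at a zero entry both sides apply
  \<open>v\<close> to the entry of \<open>s\<close>.\<close>

lemma max_tree_max_tree:
  assumes "v \<in> omega_eq k" "s \<in> omega_eq k" "t \<in> omega_eq k"
  shows "max_tree (max_tree v s) t = max_tree v (max_tree s t)"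
proof (rule nth_equalityI)
  fix i assume i: "i < length (max_tree (max_tree v s) t)"
  with assms show "max_tree (max_tree v s) t ! i = max_tree v (max_tree s t) ! i"
    using last_max_tree[OF assms(1,2)] by (auto simp: nth_max_tree omega_eq_def)
qed (use assms in \<open>auto simp: omega_eq_def\<close>)

lemma X_max_trans:
  assumes "v \<in> omega_eq k" "w \<in> X_max k v"
  shows "X_max k w \<subseteq> X_max k v"
  using assms by (force simp: X_max_def max_tree_max_tree max_tree_in_omega_eq)

lemma max_tree_zero:
  assumes "length v = k"
  shows "max_tree v (replicate k 0) = v"
  using assms by (auto simp: list_eq_iff_nth_eq nth_max_tree)

lemma self_in_X_max: "v \<in> omega_eq k \<Longrightarrow> v \<in> X_max k v"
  unfolding X_max_def image_iff
  by (rule bexI[of _ "replicate k 0"]) (auto simp: max_tree_zero omega_eq_def)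

lemma omega_eq_last_zero: "s \<in> omega_eq k \<Longrightarrow> last s = 0 \<Longrightarrow> s = replicate k 0"
  using nth_le_last by (fastforce simp: omega_eq_def list_eq_iff_nth_eq)

text \<open>Last entries add, and a nondecreasing sequence with last entry 0 is constantly 0, which
  is the argument that returns \<open>v\<close>.\<close>

lemma X_max_last:
  assumes "v \<in> omega_eq k" "1 \<le> k" "w \<in> X_max k v" "w \<noteq> v"
  shows "last v < last w"
proof -
  obtain s where s: "s \<in> omega_eq k" "w = max_tree v s" using assms(3) by (auto simp: X_max_def)
  have "last s \<noteq> 0"
  proof
    assume "last s = 0"
    then have "w = v" using s assms(1) omega_eq_last_zero[OF s(1)] by (simp add: max_tree_zero omega_eq_def)
    with assms(4) show False by simp
  qed
  then show ?thesis using s last_max_tree[OF assms(1) s(1) assms(2)] by simp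
qed

lemma last_less_imp_prec: "last s < last t \<Longrightarrow> t \<noteq> [] \<Longrightarrow> s \<prec> t"
  by (simp add: prec_def)

lemma is_prec_min_X_max:
  assumes "v \<in> omega_eq k" "1 \<le> k" "F \<subseteq> X_max k v" "v \<in> F"
  shows "is_prec_min v F"
  unfolding is_prec_min_def prec_eq_def
proof (intro conjI ballI)
  fix t assume t: "t \<in> F"
  then have "t \<in> omega_eq k" using assms by (auto simp: X_max_def max_tree_in_omega_eq)
  then have "t \<noteq> []" using assms(2) by (auto simp: omega_eq_def)
  with t X_max_last[OF assms(1,2), of t] assms(3) show "v \<prec> t \<or> v = t"
    by (auto intro: last_less_imp_prec)
qed (rule assms(4))

lemma is_E_tree_max_tree:
  assumes v: "v \<in> omega_eq k"
  shows "is_E_tree k (max_tree v)"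
  unfolding is_E_tree_def
proof (intro conjI ballI impI)
  fix s assume "s \<in> omega_le k"
  then show "max_tree v s \<in> omega_le k"
    using v by (auto simp: omega_le_def omega_eq_def sorted_max_tree)
next
  have pre: "strict_prefix (max_tree v s) (max_tree v t)"
    if sp: "strict_prefix s t" and t: "t \<in> omega_le k" for s t
  proof -
    obtain b z where u: "t = s @ b # z"
      using strict_prefix_append_ConsE[OF sp] by blast
    have len: "length v = k" "length t \<le> k" using v t by (auto simp: omega_eq_def omega_le_def)
    have "max_tree v s = take (length s) (max_tree v t)"
      using len u by (auto simp: list_eq_iff_nth_eq nth_max_tree nth_append)
    then have "prefix (max_tree v s) (max_tree v t)" by (metis take_is_prefix)
    moreover have "length (max_tree v s) < length (max_tree v t)" using u len by simp
    ultimately show ?thesis using less_irrefl unfolding strict_prefix_def by metis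
  qed
  then show "strict_prefix (max_tree v s) (max_tree v t)"
    if "strict_prefix s t" "t \<in> omega_le k" for s t using that .
  fix s t assume s: "s \<in> omega_le k" and t: "t \<in> omega_le k" and prec: "s \<prec> t"
  have len: "length v = k" "length t \<le> k" "length s \<le> k" "sorted s" "sorted t" "sorted v"
    using v s t by (auto simp: omega_eq_def omega_le_def)
  have "t \<noteq> []" using prec by (auto simp: prec_def)
  then have ht: "max_tree v t \<noteq> []" using len by (auto simp: max_tree_def)
  have sorted_t: "sorted (max_tree v t)" using len by (simp add: sorted_max_tree)
  show "max_tree v s \<prec> max_tree v t"
  proof (cases "s = []")
    case True
    with ht show ?thesis by (auto simp: prec_def max_tree_def)
  next
    case False
    have hs: "max_tree v s \<noteq> []" using len False by (auto simp: max_tree_def)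
    have last_h: "last (max_tree v r) = (if last r = 0 then v ! (length r - 1) else last v + last r)"
      if "r \<noteq> []" "length r \<le> k" for r
    proof -
      have "max_tree v r \<noteq> []" using len that by (auto simp: max_tree_def)
      then show ?thesis
        using that len by (auto simp: last_conv_nth nth_max_tree min_def)
    qed
    from prec False consider (less) "last s < last t"
      | (lex) "last s = last t" "(s, t) \<in> lexord less_than" by (auto simp: prec_def)
    then show ?thesis
    proof cases
      case less
      \<comment> \<open>A zero last entry is sent to an entry of \<open>v\<close>, which is at most
        \<open>last v\<close> and hence below \<open>last v + last t\<close>.\<close>
      have "length s - 1 < length v" using len False by (cases s) auto
      then have "v ! (length s - 1) \<le> last v" using len by (intro nth_le_last)
      then have "last (max_tree v s) < last (max_tree v t)"
        using less last_h False \<open>t \<noteq> []\<close> len by auto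
      then show ?thesis using ht by (rule last_less_imp_prec)
    next
      case lex
      from lex(2) consider (pre) b z where "t = s @ b # z"
        | (diff) u a b x y where "a < b" "s = u @ a # x" "t = u @ b # y"
        unfolding lexord_def by auto
      then show ?thesis
      proof cases
        case pre
        then have "strict_prefix s t" by (auto simp: strict_prefix_def)
        with t sorted_t show ?thesis
          by (intro strict_prefix_imp_prec \<open>\<And>t s. strict_prefix s t \<Longrightarrow> t \<in> omega_le k \<Longrightarrow>
            strict_prefix (max_tree v s) (max_tree v t)\<close>)
      next
        case diff
        define f where "f i m = (if m = 0 then v ! i else last v + m)" for i m
        \<comment> \<open>The difference \<open>a < b\<close> makes the common last entry positive,
          so both images end in \<open>last v\<close> plus it. With last entry 0 the end of the
          image would depend on the length of the argument.\<close>
        have "b \<le> last t" using diff len nth_le_last[of t "length u"] by simp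
        then have "last s \<noteq> 0" using lex(1) diff(1) by simp
        then have lasts: "last (max_tree v s) = last (max_tree v t)"
          using last_h False \<open>t \<noteq> []\<close> len lex(1) by simp
        let ?i = "length u"
        have i: "?i < length s" "?i < length t" using diff by auto
        have vi: "v ! ?i \<le> last v" using len i by (intro nth_le_last) auto
        have lt: "max_tree v s ! ?i < max_tree v t ! ?i"
          using i len diff vi by (auto simp: nth_max_tree)
        have eq: "take ?i (max_tree v s) = take ?i (max_tree v t)"
          using diff len by (auto simp: list_eq_iff_nth_eq nth_max_tree nth_append)
        have "(max_tree v s, max_tree v t) \<in> lexord less_than"
          unfolding lexord_take_index_conv using i len lt eq by auto
        then show ?thesis using ht lasts by (simp add: prec_def)
      qed
    qed
  qed
qed

lemma X_max_in_E_space: "v \<in> omega_eq k \<Longrightarrow> X_max k v \<in> E_space k"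
  unfolding X_max_def E_space_def using is_E_tree_max_tree by blast

section \<open>Iterated norms\<close>

lemma set_le_singletonD: "set_le {a} F \<Longrightarrow> b \<in> F \<Longrightarrow> a \<preceq> b"
  unfolding set_le_def is_prec_max_def is_prec_min_def by (auto intro: prec_eq_trans)

lemma set_less_singletonD: "set_less F {a} \<Longrightarrow> b \<in> F \<Longrightarrow> b \<prec> a"
  unfolding set_less_def is_prec_max_def is_prec_min_def by (auto intro: prec_eq_prec_trans)

lemma set_lessD: "set_less F G \<Longrightarrow> a \<in> F \<Longrightarrow> b \<in> G \<Longrightarrow> a \<prec> b"
  unfolding set_less_def is_prec_max_def is_prec_min_def
  by (meson prec_eq_prec_trans prec_prec_eq_trans)

text \<open>Chains the inequalities through the separating points; each intermediate
  \<open>E r\<close> is nonempty because \<open>set_le\<close> demands a least element.\<close>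

lemma admissible_less:
  assumes "admissible k d m E" "1 \<le> l" "l < l'" "l' \<le> m" "s \<in> E l" "t \<in> E l'"
  shows "s \<prec> t"
proof -
  obtain v where le: "\<And>i. i \<in> {1..m} \<Longrightarrow> set_le {v i} (E i)"
    and less: "\<And>i. i \<in> {1..<m} \<Longrightarrow> set_less (E i) {v (Suc i)}"
    using assms(1) unfolding admissible_def by blast
  have "s \<prec> v l'"
    using \<open>l < l'\<close> \<open>l' \<le> m\<close>
  proof (induction l')
    case (Suc r)
    show ?case
    proof (cases "l = r")
      case True
      then show ?thesis using less[of l] Suc.prems assms(2,5) by (auto intro: set_less_singletonD)
    next
      case False
      then have r: "s \<prec> v r" "r \<in> {1..m}" "r \<in> {1..<m}" using Suc assms(2) by auto
      obtain u where "u \<in> E r" using le[OF r(2)] by (auto simp: set_le_def is_prec_min_def)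
      then have "v r \<preceq> u" "u \<prec> v (Suc r)"
        using le[OF r(2)] less[OF r(3)] by (auto intro: set_le_singletonD set_less_singletonD)
      then show ?thesis using r(1) by (meson prec_eq_prec_trans prec_trans)
    qed
  qed simp
  moreover have "v l' \<preceq> t" using le[of l'] assms by (auto intro: set_le_singletonD)
  ultimately show ?thesis by (rule prec_prec_eq_trans)
qed

lemma admissible_disjoint:
  "admissible k d m E \<Longrightarrow> l \<in> {1..m} \<Longrightarrow> l' \<in> {1..m} \<Longrightarrow> l \<noteq> l' \<Longrightarrow> E l \<inter> E l' = {}"
  using admissible_less[of k d m E] by (auto simp: neq_iff) (metis prec_irrefl)+

text \<open>Infinitely many sequences may be admissible, but a summand depends only on the trace of
  \<open>E i\<close> on the finite support, and there are at most \<open>d\<close> pieces.\<close>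

lemma finite_admissible_sums:
  fixes N :: "(nat list \<Rightarrow> real) \<Rightarrow> real"
  assumes "finite (supp x)"
  shows "finite {\<Sum>i=1..m. N (proj (E i) x) |m E. admissible k d m E}"
proof -
  let ?G = "\<lambda>m. PiE {1..m} (\<lambda>_. Pow (supp x))"
  have "{\<Sum>i=1..m. N (proj (E i) x) |m E. admissible k d m E}
      \<subseteq> (\<Union>m\<in>{1..d}. (\<lambda>F. \<Sum>i=1..m. N (proj (F i) x)) ` ?G m)"
  proof
    fix r assume "r \<in> {\<Sum>i=1..m. N (proj (E i) x) |m E. admissible k d m E}"
    then obtain m E where r: "r = (\<Sum>i=1..m. N (proj (E i) x))" and "admissible k d m E" by blast
    then have m: "m \<in> {1..d}" by (auto simp: admissible_def)
    define F where "F = restrict (\<lambda>i. E i \<inter> supp x) {1..m}"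
    have "proj (F i) x = proj (E i) x" if "i \<in> {1..m}" for i
      using that by (auto simp: F_def proj_def supp_def)
    then have "r = (\<Sum>i=1..m. N (proj (F i) x))" unfolding r by simp
    moreover have "F \<in> ?G m" by (auto simp: F_def)
    ultimately show "r \<in> (\<Union>m\<in>{1..d}. (\<lambda>F. \<Sum>i=1..m. N (proj (F i) x)) ` ?G m)"
      using m by blast
  qed
  then show ?thesis
    by (rule finite_subset) (use assms in \<open>auto intro!: finite_PiE\<close>)
qed

lemma proj_in_c00: "x \<in> c00 k \<Longrightarrow> proj E x \<in> c00 k"
proof -
  have "supp (proj E x) \<subseteq> supp x" by (auto simp: supp_def proj_def)
  then show "x \<in> c00 k \<Longrightarrow> proj E x \<in> c00 k" by (auto simp: c00_def intro: finite_subset)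
qed

lemma scale_in_c00: "x \<in> c00 k \<Longrightarrow> (\<lambda>v. c * x v) \<in> c00 k"
proof -
  have "supp (\<lambda>v. c * x v) \<subseteq> supp x" by (auto simp: supp_def)
  then show "x \<in> c00 k \<Longrightarrow> (\<lambda>v. c * x v) \<in> c00 k" by (auto simp: c00_def intro: finite_subset)
qed

lemma proj_scale: "proj E (\<lambda>v. c * x v) = (\<lambda>v. c * proj E x v)"
  by (auto simp: proj_def)

section \<open>Monotonicity, homogeneity and limits of the iterated norms\<close>

locale T_space =
  fixes k d :: nat and \<theta> :: real
  assumes k: "1 \<le> k" and d: "1 \<le> d" and theta_pos: "0 < \<theta>" and theta_less: "\<theta> < 1"
begin

abbreviation N where "N \<equiv> T_norm_iter k d \<theta>"
abbreviation T where "T \<equiv> T_norm k d \<theta>"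

text \<open>Makes the set under \<open>Max\<close> in the recursion nonempty: the leaf of a
  one-element approximation serves both as separating point and as piece.\<close>

lemma ex_admissible: "\<exists>E. admissible k d 1 E"
proof -
  have "\<exists>u. u ` {1..1::nat} \<in> AR_n k 1 \<and> (\<forall>l\<in>{1..1::nat}. u l \<in> omega_eq k \<and> last (u l) = 0)"
    by (rule ex_approximation_with_last[where N="\<lambda>_. 0"]) (use k in auto)
  then obtain u where u: "u ` {1..1::nat} \<in> AR_n k 1" by blast
  then have "admissible k d 1 (\<lambda>_. {u 1})"
    unfolding admissible_def using d
    by (auto simp: AR_def A_family_def set_le_def is_prec_max_def is_prec_min_def intro!: exI[of _ u])
  then show ?thesis by blast
qed

lemma finite_abs_image: "x \<in> c00 k \<Longrightarrow> finite ((\<lambda>v. \<bar>x v\<bar>) ` omega_eq k)"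
  by (rule finite_subset[of _ "insert 0 ((\<lambda>v. \<bar>x v\<bar>) ` supp x)"]) (auto simp: c00_def supp_def)

lemma omega_eq_nonempty: "omega_eq k \<noteq> {}"
  using infinite_omega_eq[OF k] by auto

lemma N_0_ge: "x \<in> c00 k \<Longrightarrow> \<bar>x v\<bar> \<le> N 0 x"
proof -
  assume x: "x \<in> c00 k"
  have *: "\<bar>x v\<bar> \<le> N 0 x" if "v \<in> omega_eq k" for v
    using finite_abs_image[OF x] that by (auto intro!: Max_ge)
  obtain w where "w \<in> omega_eq k" using omega_eq_nonempty by blast
  then have "0 \<le> N 0 x" using *[of w] by linarith
  with * show ?thesis
    using x by (cases "v \<in> omega_eq k") (force simp: c00_def supp_def)+
qed

lemma N_0_attained: "x \<in> c00 k \<Longrightarrow> \<exists>v \<in> omega_eq k. N 0 x = \<bar>x v\<bar>"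
  using Max_in[OF finite_abs_image] omega_eq_nonempty by fastforce

lemma N_Suc_ge:
  assumes "x \<in> c00 k" "admissible k d m E"
  shows "\<theta> * (\<Sum>i=1..m. N j (proj (E i) x)) \<le> N (Suc j) x"
proof -
  have "(\<Sum>i=1..m. N j (proj (E i) x)) \<le>
      Max {\<Sum>i=1..m. N j (proj (E i) x) |m E. admissible k d m E}"
    using assms by (intro Max_ge finite_admissible_sums) (auto simp: c00_def)
  then show ?thesis using theta_pos by (auto simp: le_max_iff_disj)
qed

lemma N_Suc_cases:
  assumes "x \<in> c00 k"
  obtains "N (Suc j) x = N j x"
  | m E where "admissible k d m E" "N (Suc j) x = \<theta> * (\<Sum>i=1..m. N j (proj (E i) x))"
proof -
  let ?A = "{\<Sum>i=1..m. N j (proj (E i) x) |m E. admissible k d m E}"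
  have "finite ?A" using assms by (intro finite_admissible_sums) (auto simp: c00_def)
  moreover have "?A \<noteq> {}" using ex_admissible by blast
  ultimately have "Max ?A \<in> ?A" by (rule Max_in)
  then obtain m E where E: "admissible k d m E" "Max ?A = (\<Sum>i=1..m. N j (proj (E i) x))" by blast
  have "N (Suc j) x = max (N j x) (\<theta> * Max ?A)" by simp
  then show thesis using that E by (auto simp: max_def simp del: T_norm_iter.simps split: if_splits)
qed

lemma N_Suc_le:
  assumes "x \<in> c00 k" "N j x \<le> B"
    and "\<And>m E. admissible k d m E \<Longrightarrow> \<theta> * (\<Sum>i=1..m. N j (proj (E i) x)) \<le> B"
  shows "N (Suc j) x \<le> B"
  using assms(1)
proof (rule N_Suc_cases[where j=j])
  assume "N (Suc j) x = N j x"
  then show ?thesis using assms(2) by simp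
next
  fix m E assume "admissible k d m E" "N (Suc j) x = \<theta> * (\<Sum>i=1..m. N j (proj (E i) x))"
  then show ?thesis using assms(3) by simp
qed

lemma N_mono_Suc: "N j x \<le> N (Suc j) x"
  by simp

declare T_norm_iter.simps [simp del]

lemma N_nonneg: "x \<in> c00 k \<Longrightarrow> 0 \<le> N j x"
proof (induction j)
  case 0
  then show ?case using N_0_ge[of x undefined] by linarith
next
  case (Suc j)
  then show ?case using N_mono_Suc[of j x] by linarith
qed

lemma N_mono:
  assumes "x \<in> c00 k" "y \<in> c00 k" "\<And>v. \<bar>x v\<bar> \<le> \<bar>y v\<bar>"
  shows "N j x \<le> N j y"
  using assms
proof (induction j arbitrary: x y)
  case 0
  then show ?case using N_0_attained[of x] N_0_ge[of y] by (metis order_trans)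
next
  case (Suc j)
  show ?case
  proof (rule N_Suc_le)
    show "N j x \<le> N (Suc j) y"
      using Suc.IH[OF Suc.prems] N_mono_Suc[of j y] by linarith
    fix m E assume E: "admissible k d m E"
    have "N j (proj (E i) x) \<le> N j (proj (E i) y)" for i
      using Suc.prems by (intro Suc.IH proj_in_c00) (auto simp: proj_def)
    then have "\<theta> * (\<Sum>i=1..m. N j (proj (E i) x)) \<le> \<theta> * (\<Sum>i=1..m. N j (proj (E i) y))"
      using theta_pos by (intro mult_left_mono sum_mono) auto
    also have "\<dots> \<le> N (Suc j) y" using N_Suc_ge[OF _ E] Suc.prems by simp
    finally show "\<theta> * (\<Sum>i=1..m. N j (proj (E i) x)) \<le> N (Suc j) y" .
  qed (use Suc.prems in simp)
qed

lemma N_proj_le: "x \<in> c00 k \<Longrightarrow> N j (proj E x) \<le> N j x"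
  by (intro N_mono proj_in_c00) (auto simp: proj_def)

lemma N_scale_le:
  assumes "x \<in> c00 k"
  shows "N j (\<lambda>v. c * x v) \<le> \<bar>c\<bar> * N j x"
  using assms
proof (induction j arbitrary: x)
  case 0
  from N_0_attained[OF scale_in_c00[OF 0, of c]] obtain v where
    "N 0 (\<lambda>v. c * x v) = \<bar>c * x v\<bar>" by blast
  then show ?case using N_0_ge[OF 0, of v] by (simp add: abs_mult mult_left_mono)
next
  case (Suc j)
  show ?case
  proof (rule N_Suc_le)
    have "\<bar>c\<bar> * N j x \<le> \<bar>c\<bar> * N (Suc j) x" using N_mono_Suc[of j x] by (intro mult_left_mono) auto
    then show "N j (\<lambda>v. c * x v) \<le> \<bar>c\<bar> * N (Suc j) x" using Suc.IH[OF Suc.prems] by linarith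
    fix m E assume E: "admissible k d m E"
    have "\<theta> * (\<Sum>i=1..m. N j (proj (E i) (\<lambda>v. c * x v)))
        \<le> \<theta> * (\<Sum>i=1..m. \<bar>c\<bar> * N j (proj (E i) x))"
      unfolding proj_scale using theta_pos Suc.prems
      by (intro mult_left_mono sum_mono Suc.IH proj_in_c00) auto
    also have "\<dots> = \<bar>c\<bar> * (\<theta> * (\<Sum>i=1..m. N j (proj (E i) x)))"
      by (simp add: sum_distrib_left algebra_simps)
    also have "\<dots> \<le> \<bar>c\<bar> * N (Suc j) x"
      using N_Suc_ge[OF Suc.prems E] by (intro mult_left_mono) auto
    finally show "\<theta> * (\<Sum>i=1..m. N j (proj (E i) (\<lambda>v. c * x v))) \<le> \<bar>c\<bar> * N (Suc j) x" .
  qed (use Suc.prems scale_in_c00 in auto)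
qed

text \<open>Admissible sets are pairwise disjoint and \<open>\<theta> < 1\<close>, so no splitting
  exceeds the sum of all coefficients. The bound does not depend on \<open>j\<close> and makes the
  supremum defining \<open>T\<close> finite.\<close>

lemma N_le_l1:
  assumes "x \<in> c00 k"
  shows "N j x \<le> (\<Sum>v\<in>supp x. \<bar>x v\<bar>)"
  using assms
proof (induction j arbitrary: x)
  case 0
  from N_0_attained[OF 0] obtain v where "N 0 x = \<bar>x v\<bar>" by blast
  moreover have "\<bar>x v\<bar> \<le> (\<Sum>v\<in>supp x. \<bar>x v\<bar>)"
    using 0 by (cases "v \<in> supp x") (auto simp: c00_def supp_def intro!: member_le_sum sum_nonneg)
  ultimately show ?case by simp
next
  case (Suc j)
  have fin: "finite (supp x)" using Suc.prems by (auto simp: c00_def)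
  show ?case
  proof (rule N_Suc_le[OF Suc.prems Suc.IH[OF Suc.prems]])
    fix m E assume E: "admissible k d m E"
    have "N j (proj (E i) x) \<le> (\<Sum>v\<in>E i \<inter> supp x. \<bar>x v\<bar>)" for i
    proof -
      have "supp (proj (E i) x) = E i \<inter> supp x" by (auto simp: supp_def proj_def)
      then show ?thesis using Suc.IH[OF proj_in_c00[OF Suc.prems], of "E i"]
        by (auto simp: proj_def)
    qed
    then have "(\<Sum>i=1..m. N j (proj (E i) x)) \<le> (\<Sum>i=1..m. \<Sum>v\<in>E i \<inter> supp x. \<bar>x v\<bar>)"
      by (rule sum_mono)
    also have "\<dots> = (\<Sum>v\<in>(\<Union>i\<in>{1..m}. E i \<inter> supp x). \<bar>x v\<bar>)"
      using fin admissible_disjoint[OF E] by (intro sum.UNION_disjoint[symmetric]) blast+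
    also have "\<dots> \<le> (\<Sum>v\<in>supp x. \<bar>x v\<bar>)"
      using fin by (intro sum_mono2) auto
    finally have S: "(\<Sum>i=1..m. N j (proj (E i) x)) \<le> (\<Sum>v\<in>supp x. \<bar>x v\<bar>)" .
    have "0 \<le> (\<Sum>i=1..m. N j (proj (E i) x))"
      using Suc.prems by (intro sum_nonneg N_nonneg proj_in_c00)
    then have "\<theta> * (\<Sum>i=1..m. N j (proj (E i) x)) \<le> (\<Sum>i=1..m. N j (proj (E i) x))"
      using theta_less theta_pos by (intro mult_left_le_one_le) auto
    with S show "\<theta> * (\<Sum>i=1..m. N j (proj (E i) x)) \<le> (\<Sum>v\<in>supp x. \<bar>x v\<bar>)" by linarith
  qed
qed

lemma bdd_above_N: "x \<in> c00 k \<Longrightarrow> bdd_above (range (\<lambda>j. N j x))"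
  using N_le_l1 by (auto intro!: bdd_aboveI2)

lemma N_le_T: "x \<in> c00 k \<Longrightarrow> N j x \<le> T x"
  unfolding T_norm_def by (rule cSUP_upper) (auto intro: bdd_above_N)

lemma T_le: "(\<And>j. N j x \<le> B) \<Longrightarrow> T x \<le> B"
  unfolding T_norm_def by (rule cSUP_least) auto

lemma N_tendsto_T: "x \<in> c00 k \<Longrightarrow> (\<lambda>j. N j x) \<longlonglongrightarrow> T x"
  unfolding T_norm_def using N_mono_Suc
  by (intro LIMSEQ_incseq_SUP bdd_above_N incseq_SucI) auto

lemma T_nonneg: "x \<in> c00 k \<Longrightarrow> 0 \<le> T x"
  using N_le_T[of x 0] N_nonneg[of x 0] by linarith

lemma T_mono: "x \<in> c00 k \<Longrightarrow> y \<in> c00 k \<Longrightarrow> (\<And>v. \<bar>x v\<bar> \<le> \<bar>y v\<bar>) \<Longrightarrow> T x \<le> T y"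
  using N_mono[of x y] N_le_T[of y] by (intro T_le) (meson order_trans)

lemma T_scale:
  assumes "x \<in> c00 k"
  shows "T (\<lambda>v. c * x v) = \<bar>c\<bar> * T x"
proof (rule antisym)
  have le: "T (\<lambda>v. c * x v) \<le> \<bar>c\<bar> * T x" if "x \<in> c00 k" for c x
  proof (rule T_le)
    fix j show "N j (\<lambda>v. c * x v) \<le> \<bar>c\<bar> * T x"
      using N_scale_le[OF that] N_le_T[OF that] by (meson abs_ge_zero mult_left_mono order_trans)
  qed
  from le[OF assms] show "T (\<lambda>v. c * x v) \<le> \<bar>c\<bar> * T x" .
  show "\<bar>c\<bar> * T x \<le> T (\<lambda>v. c * x v)"
  proof (cases "c = 0")
    case True
    then show ?thesis using T_nonneg[OF scale_in_c00[OF assms, of c]] by simp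
  next
    case False
    then show ?thesis
      using le[OF scale_in_c00[OF assms, of c], of "1 / c"] by (simp add: field_simps)
  qed
qed

text \<open>The limit of \<open>N_Suc_ge\<close>: both sides converge because the iterates increase
  to \<open>T\<close>.\<close>

lemma T_admissible:
  assumes "x \<in> c00 k" "admissible k d m E"
  shows "\<theta> * (\<Sum>i=1..m. T (proj (E i) x)) \<le> T x"
proof (rule LIMSEQ_le)
  show "(\<lambda>j. \<theta> * (\<Sum>i=1..m. N j (proj (E i) x))) \<longlonglongrightarrow> \<theta> * (\<Sum>i=1..m. T (proj (E i) x))"
    by (intro tendsto_intros N_tendsto_T proj_in_c00 assms)
  show "(\<lambda>j. N (Suc j) x) \<longlonglongrightarrow> T x"
    using N_tendsto_T[OF assms(1)] by (rule LIMSEQ_Suc)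
  show "\<exists>n. \<forall>j\<ge>n. \<theta> * (\<Sum>i=1..m. N j (proj (E i) x)) \<le> N (Suc j) x"
    using N_Suc_ge[OF assms] by blast
qed

end

section \<open>Estimates in \<open>\<ell>\<^sub>p\<close>\<close>

text \<open>Young's inequality for the terms divided by the p-norm \<open>R\<close>, then summed.
  The second factor is normalised by a q-sum of at most 1, the form in which Kraft's inequality
  provides it.\<close>

lemma Holder_sum:
  fixes a u :: "'i \<Rightarrow> real"
  assumes pq: "1 < p" "1 < q" "1 / p + 1 / q = 1" and "finite I"
    and u: "\<And>i. i \<in> I \<Longrightarrow> 0 \<le> u i" "(\<Sum>i\<in>I. u i powr q) \<le> 1"
  shows "(\<Sum>i\<in>I. \<bar>a i\<bar> * u i) \<le> (\<Sum>i\<in>I. \<bar>a i\<bar> powr p) powr (1 / p)"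
proof -
  define S where "S = (\<Sum>i\<in>I. \<bar>a i\<bar> powr p)"
  have "0 \<le> S" by (auto simp: S_def sum_nonneg)
  show ?thesis
  proof (cases "S = 0")
    case True
    then have "\<forall>i\<in>I. a i = 0"
      using \<open>finite I\<close> by (auto simp: S_def sum_nonneg_eq_0_iff)
    then show ?thesis by simp
  next
    case False
    define R where "R = S powr (1 / p)"
    have "R > 0" using False by (simp add: R_def)
    have Rp: "R powr p = S" using pq(1) \<open>0 \<le> S\<close> by (simp add: R_def powr_powr)
    have "(\<Sum>i\<in>I. (\<bar>a i\<bar> / R) * u i) \<le> (\<Sum>i\<in>I. (\<bar>a i\<bar> / R) powr p / p + u i powr q / q)"
      using pq u \<open>R > 0\<close> by (intro sum_mono Youngs_inequality) auto
    also have "\<dots> = (\<Sum>i\<in>I. \<bar>a i\<bar> powr p / S / p) + (\<Sum>i\<in>I. u i powr q / q)"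
      using \<open>R > 0\<close> by (simp add: sum.distrib powr_divide Rp)
    also have "\<dots> = 1 / p + (\<Sum>i\<in>I. u i powr q) / q"
      using False by (simp add: sum_divide_distrib[symmetric] S_def[symmetric])
    also have "\<dots> \<le> 1 / p + 1 / q"
      using u(2) pq by (intro add_left_mono divide_right_mono) auto
    finally have "(\<Sum>i\<in>I. \<bar>a i\<bar> * u i / R) \<le> 1" using pq(3) by simp
    then have "(\<Sum>i\<in>I. \<bar>a i\<bar> * u i) / R \<le> 1" by (simp add: sum_divide_distrib)
    then show ?thesis using \<open>R > 0\<close> by (simp add: R_def[symmetric] S_def[symmetric] field_simps)
  qed
qed

text \<open>The pair \<open>(l i, u i)\<close> stands for the \<open>d\<close>-adic interval
  \<open>[u i / d ^ l i, (u i + 1) / d ^ l i)\<close>; assumption \<open>sep\<close> says that these intervals are disjoint and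
  ordered as their indices, so that splitting along \<open>d\<close>-adic intervals splits the index set into at most
  \<open>d\<close> successive pieces.\<close>

lemma dadic_tree_lower_bound:
  fixes \<Phi> :: "nat set \<Rightarrow> real" and l u :: "nat \<Rightarrow> nat" and w :: "nat \<Rightarrow> real"
  assumes "2 \<le> d" "finite A" "0 \<le> \<theta>"
    and empty: "\<Phi> {} = 0" and single: "\<And>i. i \<in> A \<Longrightarrow> w i \<le> \<Phi> {i}"
    and split: "\<And>B c. B \<subseteq> A \<Longrightarrow> c ` B \<subseteq> {..<d} \<Longrightarrow> mono_on B c \<Longrightarrow>
      \<theta> * (\<Sum>e<d. \<Phi> {i \<in> B. c i = e}) \<le> \<Phi> B"
    and sep: "\<And>i j. i \<in> A \<Longrightarrow> j \<in> A \<Longrightarrow> i < j \<Longrightarrow> (u i + 1) * d ^ l j \<le> u j * d ^ l i"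
    and unit: "\<And>i. i \<in> A \<Longrightarrow> u i < d ^ l i"
  shows "(\<Sum>i\<in>A. \<theta> ^ l i * w i) \<le> \<Phi> A"
proof -
  \<comment> \<open>For \<open>m \<le> l i\<close>, this is the number of the \<open>d\<close>-adic
    cell of level \<open>m\<close> that contains the interval of \<open>i\<close>.\<close>
  define c where "c m i = u i div d ^ (l i - m)" for m i
  have dpos: "0 < d" using assms(1) by simp
  have c_le: "q \<le> c m i \<longleftrightarrow> q * d ^ l i \<le> u i * d ^ m" if "m \<le> l i" for q m i
  proof -
    have "d ^ l i = d ^ (l i - m) * d ^ m" using that by (simp add: power_add[symmetric])
    then have "q * d ^ l i \<le> u i * d ^ m \<longleftrightarrow> q * d ^ (l i - m) \<le> u i"
      using dpos by (simp add: mult.assoc[symmetric])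
    then show ?thesis using dpos by (simp add: c_def less_eq_div_iff_mult_less_eq)
  qed
  have c_mono: "c m i \<le> c m j" if "i \<in> A" "j \<in> A" "i < j" "m \<le> l i" "m \<le> l j" for m i j
  proof -
    have "c m i * d ^ l i * d ^ l j \<le> u i * d ^ m * d ^ l j"
      using c_le[OF that(4), of "c m i"] by simp
    also have "\<dots> \<le> u j * d ^ l i * d ^ m"
      using sep[OF that(1,2,3)] mult_le_mono1[of "u i * d ^ l j" "u j * d ^ l i" "d ^ m"]
      by (simp add: algebra_simps)
    finally have "d ^ l i * (c m i * d ^ l j) \<le> d ^ l i * (u j * d ^ m)"
      by (simp add: algebra_simps)
    then have "c m i * d ^ l j \<le> u j * d ^ m" using dpos by simp
    then show ?thesis using c_le[OF that(5)] by simp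
  qed
  \<comment> \<open>If one of two disjoint intervals is itself a cell of level \<open>m\<close>,
    they lie in different cells of that level; so an interval of level \<open>m\<close> is alone in
    its cell.\<close>
  have c_strict: "c m i < c m j"
    if "i \<in> A" "j \<in> A" "i < j" "m \<le> l i" "m \<le> l j" "l i = m \<or> l j = m" for m i j
    using that(6)
  proof
    assume "l i = m"
    then have "Suc (c m i) * d ^ l j \<le> u j * d ^ m" using sep[OF that(1,2,3)] by (simp add: c_def)
    then have "Suc (c m i) \<le> c m j" using c_le[OF that(5)] by blast
    then show ?thesis by simp
  next
    assume j: "l j = m"
    show ?thesis
    proof (rule ccontr)
      assume "\<not> c m i < c m j"
      then have "c m j \<le> c m i" by simp
      then have "u j * d ^ l i \<le> u i * d ^ l j" using c_le[OF that(4), of "c m j"] j by (simp add: c_def)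
      moreover have "(u i + 1) * d ^ l j > u i * d ^ l j" using dpos by simp
      ultimately show False using sep[OF that(1,2,3)] by linarith
    qed
  qed
  \<comment> \<open>Induction on the remaining depth \<open>r\<close>: \<open>B\<close> lies in one
    cell of level \<open>m\<close>, and its intervals have levels from \<open>m\<close> to
    \<open>m + r\<close>.\<close>
  have main: "(\<Sum>i\<in>B. \<theta> ^ (l i - m) * w i) \<le> \<Phi> B"
    if "B \<subseteq> A" "\<And>i. i \<in> B \<Longrightarrow> m \<le> l i \<and> l i \<le> m + r" "\<And>i j. i \<in> B \<Longrightarrow> j \<in> B \<Longrightarrow> c m i = c m j"
    for B m r
    using that
  proof (induction r arbitrary: m B)
    case 0
    have same: "i = j" if "i \<in> B" "j \<in> B" for i j
      using 0 that c_strict[of i j m] c_strict[of j i m] by (metis add_0_right le_antisym less_irrefl linorder_neqE_nat subsetD)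
    show ?case
    proof (cases "B = {}")
      case True then show ?thesis by (simp add: empty)
    next
      case False
      then obtain i where "B = {i}" using same by blast
      then show ?thesis using 0 single[of i] by auto
    qed
  next
    case (Suc r)
    show ?case
    proof (cases "\<exists>i\<in>B. l i = m")
      case True
      then obtain i where i: "i \<in> B" "l i = m" by blast
      have "j = i" if "j \<in> B" for j
        using Suc.prems i that c_strict[of i j m] c_strict[of j i m] by (metis less_irrefl linorder_neqE_nat subsetD)
      then have "B = {i}" using i by blast
      then show ?thesis using single[of i] Suc.prems(1) i by simp
    next
      case False
      then have lB: "Suc m \<le> l i \<and> l i \<le> Suc m + r" if "i \<in> B" for i
        using Suc.prems(2)[OF that] that by (metis add_Suc_shift le_neq_implies_less Suc_leI)
      have c_div: "c (Suc m) i div d = c m i" if "i \<in> B" for i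
      proof -
        have "l i - m = Suc (l i - Suc m)" using lB[OF that] by linarith
        then show ?thesis by (simp add: c_def div_mult2_eq[symmetric] mult.commute)
      qed
      \<comment> \<open>The next base-\<open>d\<close> digit. It names the child cell and, inside
        one cell of level \<open>m\<close>, is nondecreasing in the index, so \<open>split\<close>
        applies.\<close>
      define e where "e i = c (Suc m) i mod d" for i
      have c_eq: "c (Suc m) i = c m i * d + e i" if "i \<in> B" for i
        using c_div[OF that] by (metis div_mult_mod_eq e_def)
      have "mono_on B e"
      proof (rule mono_onI)
        fix i j assume ij: "i \<in> B" "j \<in> B" "i \<le> j"
        then have "c (Suc m) i \<le> c (Suc m) j"
          using c_mono[of i j "Suc m"] lB Suc.prems(1) by (cases "i = j") auto
        then show "e i \<le> e j" using c_eq ij Suc.prems(3)[OF ij(1,2)] by simp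
      qed
      moreover have e: "e ` B \<subseteq> {..<d}" using dpos by (auto simp: e_def)
      ultimately have le: "\<theta> * (\<Sum>f<d. \<Phi> {i \<in> B. e i = f}) \<le> \<Phi> B"
        using Suc.prems(1) by (intro split)
      have IH: "(\<Sum>i | i \<in> B \<and> e i = f. \<theta> ^ (l i - Suc m) * w i) \<le> \<Phi> {i \<in> B. e i = f}" for f
      proof (rule Suc.IH)
        fix i j assume "i \<in> {i \<in> B. e i = f}" "j \<in> {i \<in> B. e i = f}"
        then show "c (Suc m) i = c (Suc m) j" using c_eq Suc.prems(3)[of i j] by simp
      qed (use Suc.prems(1) lB in auto)
      have fB: "finite B" using Suc.prems(1) assms(2) finite_subset by blast
      have "(\<Sum>i\<in>B. \<theta> ^ (l i - m) * w i) = (\<Sum>i\<in>B. \<theta> * (\<theta> ^ (l i - Suc m) * w i))"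
      proof (rule sum.cong[OF refl])
        fix i assume "i \<in> B"
        then have "l i - m = Suc (l i - Suc m)" using lB[of i] by linarith
        then show "\<theta> ^ (l i - m) * w i = \<theta> * (\<theta> ^ (l i - Suc m) * w i)" by simp
      qed
      also have "\<dots> = \<theta> * (\<Sum>i\<in>B. \<theta> ^ (l i - Suc m) * w i)" by (simp add: sum_distrib_left)
      also have "(\<Sum>i\<in>B. \<theta> ^ (l i - Suc m) * w i)
          = (\<Sum>f<d. \<Sum>i | i \<in> B \<and> e i = f. \<theta> ^ (l i - Suc m) * w i)"
        using sum.group[OF fB, of "{..<d}" e "\<lambda>i. \<theta> ^ (l i - Suc m) * w i"] e by simp
      also have "\<theta> * \<dots> \<le> \<theta> * (\<Sum>f<d. \<Phi> {i \<in> B. e i = f})"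
        using assms(3) IH by (intro mult_left_mono sum_mono) auto
      finally show ?thesis using le by linarith
    qed
  qed
  \<comment> \<open>At level 0 there is a single cell, by \<open>unit\<close>, and the sum of all
    levels bounds each of them.\<close>
  have "l i \<le> (\<Sum>j\<in>A. l j)" if "i \<in> A" for i using assms(2) that by (simp add: member_le_sum)
  moreover have "c 0 i = 0" if "i \<in> A" for i using unit[OF that] by (simp add: c_def)
  ultimately show ?thesis using main[of A 0 "\<Sum>j\<in>A. l j"] by simp
qed

text \<open>With \<open>w i = \<bar>a i\<bar> powr p / S\<close> as lengths, the chosen
  \<open>d\<close>-adic intervals satisfy \<open>2 \<le> w i * d ^ l i \<le> 2 * d\<close>. Hence
  \<open>\<theta> ^ l i\<close> is at least \<open>(w i / (2 * d)) powr (1 / q)\<close>, and the sum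
  of \<open>\<bar>a i\<bar> * w i powr (1 / q)\<close> is \<open>S powr (1 / p)\<close>.\<close>

lemma lp_lower_bound:
  fixes \<Phi> :: "nat set \<Rightarrow> real" and a :: "nat \<Rightarrow> real"
  assumes d: "2 \<le> d" and A: "finite A" and "0 < \<theta>"
    and pq: "1 < p" "1 < q" "1 / p + 1 / q = 1" and theta: "\<theta> powr q = 1 / real d"
    and empty: "\<Phi> {} = 0" and single: "\<And>i. i \<in> A \<Longrightarrow> \<bar>a i\<bar> \<le> \<Phi> {i}"
    and nz: "\<And>i. i \<in> A \<Longrightarrow> a i \<noteq> 0"
    and split: "\<And>B c. B \<subseteq> A \<Longrightarrow> c ` B \<subseteq> {..<d} \<Longrightarrow> mono_on B c \<Longrightarrow>
      \<theta> * (\<Sum>e<d. \<Phi> {i \<in> B. c i = e}) \<le> \<Phi> B"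
  shows "(\<Sum>i\<in>A. \<bar>a i\<bar> powr p) powr (1 / p) \<le> (2 * real d) powr (1 / q) * \<Phi> A"
proof (cases "A = {}")
  case True
  then show ?thesis by (simp add: empty)
next
  case False
  define S where "S = (\<Sum>i\<in>A. \<bar>a i\<bar> powr p)"
  have S: "0 < S" unfolding S_def using False A nz by (intro sum_pos) auto
  define w where "w i = \<bar>a i\<bar> powr p / S" for i
  have wpos: "0 < w i" if "i \<in> A" for i using nz[OF that] S by (simp add: w_def)
  have wsum: "(\<Sum>i\<in>A. w i) = 1"
    using S by (simp add: w_def sum_divide_distrib[symmetric] S_def[symmetric])
  have wle: "w i \<le> 1" if "i \<in> A" for i
    using member_le_sum[of i A w] that wsum wpos A by (simp add: less_imp_le)
  define s where "s i = (\<Sum>j | j \<in> A \<and> j < i. w j)" for i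
  have s0: "0 \<le> s i" for i unfolding s_def using wpos by (intro sum_nonneg) (auto simp: less_imp_le)
  have s_step: "s i + w i \<le> s j" if "i \<in> A" "j \<in> A" "i < j" for i j
  proof -
    have "s i + w i = (\<Sum>j\<in>insert i {j \<in> A. j < i}. w j)" using A by (simp add: s_def)
    also have "\<dots> \<le> s j" unfolding s_def
      using that A wpos by (intro sum_mono2) (auto simp: less_imp_le)
    finally show ?thesis .
  qed
  have s1: "s i + w i \<le> 1" if "i \<in> A" for i
  proof -
    have "s i + w i = (\<Sum>j\<in>insert i {j \<in> A. j < i}. w j)" using A by (simp add: s_def)
    also have "\<dots> \<le> (\<Sum>i\<in>A. w i)"
      using that A wpos by (intro sum_mono2) (auto simp: less_imp_le)
    finally show ?thesis using wsum by simp
  qed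
  have ex: "\<exists>n. 2 \<le> w i * real d ^ n" if "i \<in> A" for i
  proof -
    obtain n where "2 / w i < real d ^ n" using real_arch_pow[of "real d" "2 / w i"] d by auto
    then show ?thesis using wpos[OF that] by (auto simp: field_simps intro!: exI[of _ n])
  qed
  \<comment> \<open>The factor 2 ensures that an interval of length \<open>w i\<close> contains a
    full grid cell of level \<open>l i\<close>; minimality keeps the two lengths comparable.\<close>
  define l where "l i = (LEAST n. 2 \<le> w i * real d ^ n)" for i
  have l: "2 \<le> w i * real d ^ l i" if "i \<in> A" for i
    unfolding l_def by (rule LeastI_ex[OF ex[OF that]])
  have l_small: "w i * real d ^ l i \<le> 2 * real d" if "i \<in> A" for i
  proof -
    \<comment> \<open>Since \<open>w i \<le> 1 < 2\<close>, level 0 is excluded; minimality then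
      applies to the predecessor of \<open>l i\<close> and costs one factor
      \<open>d\<close>.\<close>
    have "l i \<noteq> 0" using l[OF that] wle[OF that] by (intro notI) simp
    then obtain n where n: "l i = Suc n" by (cases "l i") auto
    then have "\<not> 2 \<le> w i * real d ^ n" unfolding l_def by (metis lessI not_less_Least)
    then show ?thesis using n d by (simp add: algebra_simps)
  qed
  \<comment> \<open>The first grid point of mesh \<open>1 / d ^ l i\<close> at or after
    \<open>s i\<close>.\<close>
  define u where "u i = nat \<lceil>s i * real d ^ l i\<rceil>" for i
  have dl: "0 < real d ^ l i" for i using d by simp
  have u_ge: "s i * real d ^ l i \<le> real (u i)" for i
    unfolding u_def using s0[of i] dl[of i] by (simp add: of_nat_ceiling)
  have u_less: "real (u i) < s i * real d ^ l i + 1" for i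
    unfolding u_def using s0[of i] dl[of i] by (simp add: ceiling_correct) linarith
  have u_next: "real (u i) + 1 < (s i + w i) * real d ^ l i" if "i \<in> A" for i
    using u_less[of i] l[OF that] by (simp add: algebra_simps)
  have tree: "(\<Sum>i\<in>A. \<theta> ^ l i * \<bar>a i\<bar>) \<le> \<Phi> A"
  proof (rule dadic_tree_lower_bound[OF d A _ empty single split])
    show "(u i + 1) * d ^ l j \<le> u j * d ^ l i" if "i \<in> A" "j \<in> A" "i < j" for i j
    proof -
      have "(real (u i) + 1) * real d ^ l j \<le> (s i + w i) * real d ^ l i * real d ^ l j"
        using u_next[OF that(1)] dl by (intro mult_right_mono) (auto simp: less_imp_le)
      also have "\<dots> \<le> (s j * real d ^ l j) * real d ^ l i"
        using mult_right_mono[OF s_step[OF that], of "real d ^ l i * real d ^ l j"] by (simp add: algebra_simps)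
      also have "\<dots> \<le> real (u j) * real d ^ l i"
        using u_ge[of j] dl[of i] by (intro mult_right_mono) (auto simp: less_imp_le)
      finally have "real ((u i + 1) * d ^ l j) \<le> real (u j * d ^ l i)" by (simp add: algebra_simps)
      then show ?thesis by (simp only: of_nat_le_iff)
    qed
    show "u i < d ^ l i" if "i \<in> A" for i
    proof -
      have "real (u i) < 1 * real d ^ l i"
        using u_next[OF that] s1[OF that] dl[of i] mult_right_mono[of "s i + w i" 1 "real d ^ l i"] by linarith
      then have "real (u i) < real (d ^ l i)" by simp
      then show ?thesis by (simp only: of_nat_less_iff)
    qed
  qed (use assms(3) in auto)
  define D where "D = (2 * real d) powr (1 / q)"
  have "D > 0" using d by (simp add: D_def)
  have weight: "\<bar>a i\<bar> powr p * S powr (- 1 / q) \<le> D * (\<theta> ^ l i * \<bar>a i\<bar>)" if "i \<in> A" for i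
  proof -
    have "w i \<le> (2 * real d) * (1 / real d) ^ l i"
      using l_small[OF that] dl[of i] by (simp add: power_divide field_simps)
    also have "(1 / real d) ^ l i = (\<theta> ^ l i) powr q"
      using assms(3) by (simp add: theta[symmetric] powr_powr powr_realpow[symmetric] mult.commute)
    finally have "w i powr (1 / q) \<le> ((2 * real d) * (\<theta> ^ l i) powr q) powr (1 / q)"
      using wpos[OF that] pq by (intro powr_mono2) auto
    also have "\<dots> = D * \<theta> ^ l i"
      using assms(3) pq d by (simp add: powr_mult powr_powr D_def)
    finally have "w i powr (1 / q) * \<bar>a i\<bar> \<le> D * \<theta> ^ l i * \<bar>a i\<bar>" by (intro mult_right_mono) auto
    moreover have "w i powr (1 / q) * \<bar>a i\<bar> = \<bar>a i\<bar> powr p * S powr (- 1 / q)"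
    proof -
      have "p / q + 1 = p"
      proof -
        have "p * (1 / p + 1 / q) = p" using pq(3) by simp
        then show ?thesis using pq(1) by (simp add: distrib_left)
      qed
      then have "\<bar>a i\<bar> powr (p / q) * \<bar>a i\<bar> = \<bar>a i\<bar> powr p"
        using nz[OF that] powr_add[of "\<bar>a i\<bar>" "p / q" 1] by simp
      moreover have "w i powr (1 / q) = \<bar>a i\<bar> powr (p / q) * S powr (- 1 / q)"
        using S by (simp add: w_def powr_divide powr_powr powr_minus_divide)
      ultimately show ?thesis by (simp add: mult.assoc mult.commute mult.left_commute)
    qed
    ultimately show ?thesis by (simp add: algebra_simps)
  qed
  have "1 / p = 1 + (- 1 / q)" using pq(3) by simp
  then have "S powr (1 / p) = S powr (1 + (- 1 / q))" by (rule arg_cong)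
  also have "\<dots> = S * S powr (- 1 / q)" using S by (subst powr_add) simp
  also have "\<dots> = (\<Sum>i\<in>A. \<bar>a i\<bar> powr p * S powr (- 1 / q))"
    by (simp add: S_def sum_distrib_right)
  also have "\<dots> \<le> (\<Sum>i\<in>A. D * (\<theta> ^ l i * \<bar>a i\<bar>))" by (rule sum_mono[OF weight])
  also have "\<dots> = D * (\<Sum>i\<in>A. \<theta> ^ l i * \<bar>a i\<bar>)" by (simp add: sum_distrib_left)
  also have "\<dots> \<le> D * \<Phi> A" using tree \<open>D > 0\<close> by simp
  finally show ?thesis by (simp add: D_def S_def)
qed

section \<open>The upper estimate\<close>

text \<open>Bounds the number of pieces of a splitting that meet block \<open>i\<close> and also
  another block: one if \<open>i\<close> is an end of \<open>I\<close>, two otherwise.\<close>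

definition end_weight :: "nat set \<Rightarrow> nat \<Rightarrow> real" where
  "end_weight I i = (if (\<forall>j\<in>I. i \<le> j) \<or> (\<forall>j\<in>I. j \<le> i) then 1 else 2)"

lemma end_weight_bounds: "1 \<le> end_weight I i" "end_weight I i \<le> 2"
  by (auto simp: end_weight_def)

lemma end_weight_mono: "J \<subseteq> I \<Longrightarrow> end_weight J i \<le> end_weight I i"
  by (auto simp: end_weight_def)

text \<open>The normalisation says \<open>w * \<theta> = 1 / (1 - \<theta>)\<close>, a geometric
  series. The third equation is its recursion: an absorbed contribution 1 plus the next level,
  damped by \<open>\<theta>\<close>.\<close>

lemma end_constant:
  fixes w \<theta> :: real
  assumes "0 < \<theta>" "\<theta> < 1" "w * \<theta> * (1 - \<theta>) = 1"
  shows "0 < w" "1 \<le> w * \<theta>" "1 + w * \<theta> * \<theta> = w * \<theta>"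
proof -
  have "w * (\<theta> * (1 - \<theta>)) > 0" using assms by (simp add: mult.assoc)
  then show "0 < w" by (rule zero_less_mult_pos2) (use assms in simp)
  show "1 + w * \<theta> * \<theta> = w * \<theta>" using assms(3) by (simp add: algebra_simps)
  moreover have "0 \<le> w * \<theta> * \<theta>" using \<open>0 < w\<close> assms(1) by simp
  ultimately show "1 \<le> w * \<theta>" by linarith
qed

text \<open>One step of the upper estimate. The sets \<open>I l\<close> collect the blocks met by the pieces of an
  admissible splitting; \<open>i\<close> is a fixed block. The pieces meeting no other block contribute at most 1
  in total. Unless a single piece meets \<open>i\<close>, every other piece meeting \<open>i\<close> has \<open>i\<close> as an end
  point, and there are at most two of them, at most one if \<open>i\<close> is an end point of \<open>J\<close>.\<close>

lemma splitting_step: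
  fixes I :: "nat \<Rightarrow> nat set" and u :: "nat \<Rightarrow> real"
  assumes theta: "0 < \<theta>" "\<theta> < 1" and w: "w * \<theta> * (1 - \<theta>) = 1"
    and J: "\<And>l. l \<in> {1..m} \<Longrightarrow> I l \<subseteq> J"
    and ord: "\<And>l l' r r'. 1 \<le> l \<Longrightarrow> l < l' \<Longrightarrow> l' \<le> m \<Longrightarrow> r \<in> I l \<Longrightarrow> r' \<in> I l' \<Longrightarrow> r \<le> r'"
    and i: "i \<in> J"
    and L_def: "L = {l \<in> {1..m}. i \<in> I l}" and "L \<noteq> {}"
    and u: "\<And>l. l \<in> L \<Longrightarrow> 0 \<le> u l \<and> u l \<le> 1" "\<And>l. l \<in> L \<Longrightarrow> I l \<noteq> {i} \<Longrightarrow> u l \<le> \<theta>"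
      "\<And>l. l \<in> L \<Longrightarrow> I l = {i} \<Longrightarrow> u l = 1"
  shows "(\<Sum>l | l \<in> L \<and> I l \<noteq> {i}. \<theta> * w * end_weight (I l) i * u l) + of_bool (\<exists>l\<in>L. I l = {i})
      \<le> w * end_weight J i * (\<theta> * Max (u ` L))"
proof -
  define M where "M = Max (u ` L)"
  have fin: "finite L" by (simp add: L_def)
  note wpos = end_constant(1)[OF theta w] and w2 = end_constant(2)[OF theta w]
    and w1 = end_constant(3)[OF theta w]
  have uM: "u l \<le> M" if "l \<in> L" for l unfolding M_def using that fin by (intro Max_ge) auto
  have M0: "0 \<le> M" using uM u(1) \<open>L \<noteq> {}\<close> by force
  define NL where "NL = {l \<in> L. I l \<noteq> {i}}"
  define X where "X \<longleftrightarrow> (\<exists>l\<in>L. I l = {i})"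
  have MX: "M = 1" if X
  proof -
    have "M \<le> 1" unfolding M_def using fin \<open>L \<noteq> {}\<close> u(1) by (intro Max.boundedI) auto
    moreover have "1 \<le> M" using that uM u(3) by (fastforce simp: X_def)
    ultimately show ?thesis by simp
  qed
  have goal: "(\<Sum>l\<in>NL. \<theta> * w * end_weight (I l) i * u l) + of_bool X \<le> w * end_weight J i * (\<theta> * M)"
  \<comment> \<open>A single piece meeting \<open>i\<close> is either absorbed or inherits
    \<open>i\<close> with an end weight that has not grown, since \<open>I l\<close> lies in
    \<open>J\<close>.\<close>
  proof (cases "\<exists>l. L = {l}")
    case True
    then obtain l where l: "L = {l}" by blast
    then have l': "l \<in> {1..m}" and Mu: "M = u l" by (auto simp: L_def M_def)
    show ?thesis
    proof (cases "I l = {i}")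
      case True
      then have "NL = {}" "M = 1" using l Mu u(3) by (auto simp: NL_def)
      moreover have "1 * 1 \<le> (w * \<theta>) * end_weight J i"
        using w2 end_weight_bounds by (intro mult_mono) auto
      ultimately show ?thesis by (simp add: algebra_simps)
    next
      case False
      then have "NL = {l}" "\<not> X" using l by (auto simp: NL_def X_def)
      moreover have "(\<theta> * w * M) * end_weight (I l) i \<le> (\<theta> * w * M) * end_weight J i"
        using theta wpos M0 J[OF l'] end_weight_mono by (intro mult_left_mono) auto
      ultimately show ?thesis using Mu by (simp add: algebra_simps)
    qed
  next
    case False
    define lo hi where "lo = Min L" and "hi = Max L"
    have lo: "lo \<in> L" and hi: "hi \<in> L" using fin \<open>L \<noteq> {}\<close> by (auto simp: lo_def hi_def)
    have between: "lo \<le> l" "l \<le> hi" if "l \<in> L" for l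
      using that fin by (auto simp: lo_def hi_def)
    have "lo < hi"
    proof (rule ccontr)
      assume "\<not> lo < hi"
      then have "L = {lo}" using between lo by force
      with False show False by blast
    qed
    \<comment> \<open>Now several pieces meet \<open>i\<close>. All but the last end at
      \<open>i\<close> and all but the first begin there, so the pieces strictly between meet
      \<open>i\<close> alone.\<close>
    have above: "r \<le> i" if "l \<in> L" "l < hi" "r \<in> I l" for l r
      using ord[of l hi r i] that hi by (auto simp: L_def)
    have below: "i \<le> r" if "l \<in> L" "lo < l" "r \<in> I l" for l r
      using ord[of lo l i r] that lo by (auto simp: L_def)
    have mem: "i \<in> I l" if "l \<in> L" for l using that by (simp add: L_def)
    have NL_sub: "NL \<subseteq> {lo, hi}"
    proof
      fix l assume l: "l \<in> NL"
      show "l \<in> {lo, hi}"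
      proof (rule ccontr)
        assume "l \<notin> {lo, hi}"
        then have "lo < l" "l < hi" "l \<in> L" using l between[of l] by (auto simp: NL_def)
        then have "r = i" if "r \<in> I l" for r
          using above[of l r] below[of l r] that by (simp add: le_antisym)
        then have "I l = {i}" using mem[OF \<open>l \<in> L\<close>] by blast
        with l show False by (simp add: NL_def)
      qed
    qed
    have weight: "end_weight (I l) i = 1" if "l \<in> NL" for l
      using that above below NL_sub \<open>lo < hi\<close> by (auto simp: end_weight_def NL_def)
    have "(\<Sum>l\<in>NL. \<theta> * w * end_weight (I l) i * u l) = (\<Sum>l\<in>NL. \<theta> * w * u l)"
      using weight by (intro sum.cong) auto
    also have "\<dots> \<le> (\<Sum>l\<in>NL. \<theta> * w * min \<theta> M)"
      using theta wpos u(2) uM by (intro sum_mono mult_left_mono) (auto simp: NL_def)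
    also have "\<dots> = real (card NL) * (\<theta> * w * min \<theta> M)" by simp
    finally have sum: "(\<Sum>l\<in>NL. \<theta> * w * end_weight (I l) i * u l)
      \<le> real (card NL) * (\<theta> * w * min \<theta> M)" .
    have min0: "0 \<le> \<theta> * w * min \<theta> M" using theta wpos M0 by simp
    have minM: "\<theta> * w * min \<theta> M \<le> \<theta> * w * M" "\<theta> * w * min \<theta> M \<le> \<theta> * w * \<theta>"
      using theta wpos by (auto intro!: mult_left_mono)
    show ?thesis
    proof (cases "end_weight J i = 1")
      \<comment> \<open>If \<open>i\<close> is an end of \<open>J\<close>, an outer piece meets
        \<open>i\<close> alone. What remains is the unit term and at most one damped piece, exactly
        balanced by \<open>1 + w * \<theta> * \<theta> = w * \<theta>\<close>.\<close>
      case True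
      then have "(\<forall>j\<in>J. i \<le> j) \<or> (\<forall>j\<in>J. j \<le> i)" by (auto simp: end_weight_def split: if_splits)
      then have ends: "I lo = {i} \<or> I hi = {i}"
      proof
        assume "\<forall>j\<in>J. i \<le> j"
        then have "r = i" if "r \<in> I lo" for r
          using above[OF lo \<open>lo < hi\<close> that] J[of lo] lo that by (auto simp: L_def intro: le_antisym)
        then have "I lo = {i}" using mem[OF lo] by blast
        then show ?thesis ..
      next
        assume "\<forall>j\<in>J. j \<le> i"
        then have "r = i" if "r \<in> I hi" for r
          using below[OF hi \<open>lo < hi\<close> that] J[of hi] hi that by (auto simp: L_def intro: le_antisym)
        then have "I hi = {i}" using mem[OF hi] by blast
        then show ?thesis ..
      qed
      then have "X" using lo hi by (auto simp: X_def)
      have "NL \<subseteq> {lo} \<or> NL \<subseteq> {hi}" using ends NL_sub by (auto simp: NL_def)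
      then have "card NL \<le> 1"
        using card_mono[of "{lo}" NL] card_mono[of "{hi}" NL] by auto
      then have "real (card NL) * (\<theta> * w * min \<theta> M) \<le> 1 * (\<theta> * w * min \<theta> M)"
        using min0 by (intro mult_right_mono) auto
      then show ?thesis
        using sum minM w1 MX \<open>X\<close> True by (simp add: algebra_simps)
    next
      \<comment> \<open>Here two damped pieces may remain, but the weight 2 doubles the right-hand
        side.\<close>
      case False
      then have W: "end_weight J i = 2" by (auto simp: end_weight_def split: if_splits)
      have "card NL \<le> 2" using card_mono[OF _ NL_sub] \<open>lo < hi\<close> by simp
      then have two: "real (card NL) * (\<theta> * w * min \<theta> M) \<le> 2 * (\<theta> * w * min \<theta> M)"
        using min0 by (intro mult_right_mono) auto
      show ?thesis
      proof (cases X)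
        case True
        then show ?thesis using sum two minM w1 MX W by (simp add: algebra_simps)
      next
        case False
        then show ?thesis using sum two minM W by (simp add: algebra_simps)
      qed
    qed
  qed
  then show ?thesis by (simp add: NL_def X_def M_def)
qed

section \<open>Linear combinations of blocks and the weights of their splittings\<close>

locale T_blocks = T_space +
  fixes x :: "nat \<Rightarrow> nat list \<Rightarrow> real"
  assumes x_c00: "\<And>i. x i \<in> c00 k" and T_x: "\<And>i. T (x i) = 1"
    and x_less: "\<And>i j s t. i < j \<Longrightarrow> s \<in> supp (x i) \<Longrightarrow> t \<in> supp (x j) \<Longrightarrow> s \<prec> t"
begin

definition comb :: "nat set \<Rightarrow> (nat \<Rightarrow> real) \<Rightarrow> nat list \<Rightarrow> real" where
  "comb A a = (\<lambda>t. \<Sum>i\<in>A. a i * x i t)"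

lemma lincomb_eq_comb: "lincomb n a x = comb {..<n} a"
  by (simp add: lincomb_def comb_def)

lemma supp_x_disjoint: "s \<in> supp (x i) \<Longrightarrow> s \<in> supp (x j) \<Longrightarrow> i = j"
  using x_less[of i j s s] x_less[of j i s s] by (metis linorder_neqE_nat prec_irrefl)

lemma comb_at:
  assumes "finite A" "i \<in> A" "s \<in> supp (x i)"
  shows "comb A a s = a i * x i s"
proof -
  have "x j s = 0" if "j \<noteq> i" for j using supp_x_disjoint[OF assms(3), of j] that by (auto simp: supp_def)
  then have "(\<Sum>j\<in>A. a j * x j s) = (\<Sum>j\<in>A. if j = i then a i * x i s else 0)"
    by (intro sum.cong) auto
  then show ?thesis using assms by (simp add: comb_def)
qed

lemma comb_zero: "(\<And>i. i \<in> A \<Longrightarrow> s \<notin> supp (x i)) \<Longrightarrow> comb A a s = 0"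
  by (simp add: comb_def supp_def)

lemma comb_in_c00: "finite A \<Longrightarrow> comb A a \<in> c00 k"
proof -
  assume A: "finite A"
  have "supp (comb A a) \<subseteq> (\<Union>i\<in>A. supp (x i))"
    using comb_zero[of A _ a] by (auto simp: supp_def)
  moreover have "finite (\<Union>i\<in>A. supp (x i))" using A x_c00 by (auto simp: c00_def)
  ultimately show ?thesis using x_c00 finite_subset unfolding c00_def by blast
qed

definition met :: "nat set \<Rightarrow> nat list set \<Rightarrow> nat set" where
  "met A E = {i \<in> A. supp (x i) \<inter> E \<noteq> {}}"

lemma N_zero: "N j (\<lambda>_. 0) = 0"
  using N_scale_le[OF x_c00, of j 0] N_nonneg[OF scale_in_c00[OF x_c00], of j 0] by simp

lemma N_x_le: "N j (x i) \<le> 1"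
  using N_le_T[OF x_c00] T_x by metis

text \<open>The restricted combination is zero or a multiple of one restricted block. The norm of
  that restriction is kept so that several such pieces of a block can be summed later.\<close>

lemma N_proj_small:
  assumes A: "finite A" and card: "card (met A E) < 2"
  shows "N j (proj E (comb A a)) \<le> (\<Sum>i\<in>met A E. \<bar>a i\<bar> * N j (proj E (x i)))"
proof -
  have "finite (met A E)" using A by (simp add: met_def)
  with card consider "met A E = {}" | i where "met A E = {i}"
    by (auto simp: less_Suc_eq numeral_2_eq_2 card_1_singleton_iff)
  then show ?thesis
  proof cases
    case 1
    then have "proj E (comb A a) = (\<lambda>_. 0)"
      by (auto simp: proj_def met_def fun_eq_iff intro!: comb_zero)
    then show ?thesis using 1 by (simp add: N_zero)
  next
    case (2 i)
    then have "i \<in> A" by (auto simp: met_def)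
    have "proj E (comb A a) s = a i * proj E (x i) s" for s
    proof (cases "s \<in> E \<and> s \<in> supp (x i)")
      case True
      then show ?thesis using comb_at[OF A \<open>i \<in> A\<close>] by (simp add: proj_def)
    next
      case False
      have "comb A a s = 0" if "s \<in> E"
      proof (rule comb_zero)
        fix j assume "j \<in> A"
        with that 2 False show "s \<notin> supp (x j)" by (auto simp: met_def)
      qed
      then show ?thesis using False by (auto simp: proj_def supp_def)
    qed
    then have "proj E (comb A a) = (\<lambda>s. a i * proj E (x i) s)" by blast
    then show ?thesis using 2 N_scale_le[OF proj_in_c00[OF x_c00]] by simp
  qed
qed

lemma met_ordered:
  assumes "admissible k d m E" "1 \<le> l" "l < l'" "l' \<le> m"
    "r \<in> met A (E l \<inter> F)" "r' \<in> met A (E l' \<inter> F)"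
  shows "r \<le> r'"
proof (rule ccontr)
  assume "\<not> r \<le> r'"
  obtain s t where st: "s \<in> supp (x r)" "s \<in> E l" "t \<in> supp (x r')" "t \<in> E l'"
    using assms(5,6) by (auto simp: met_def)
  then have "s \<prec> t" using admissible_less[OF assms(1-4)] by blast
  moreover have "t \<prec> s" using x_less[of r' r t s] st \<open>\<not> r \<le> r'\<close> by simp
  ultimately show False using prec_asym by blast
qed

text \<open>Induction on \<open>j\<close> for all restricting sets \<open>E\<close>, because the
  pieces of a splitting are again such restrictions. \<open>u\<close> carries the weights of the
  leaves: 1 when only block \<open>i\<close> is met, otherwise at most \<open>\<theta>\<close>, as
  \<open>splitting_step\<close> requires. The q-sum is Kraft's inequality; \<open>w\<close> and
  \<open>end_weight\<close> pay for repeated cuts of a block.\<close>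

lemma N_weights:
  assumes A: "finite A" and q: "0 < q" "\<theta> powr q = 1 / real d" and w: "w * \<theta> * (1 - \<theta>) = 1"
  shows "\<exists>u. (\<forall>i\<in>met A E. 0 \<le> u i \<and> u i \<le> 1 \<and> (met A E \<noteq> {i} \<longrightarrow> u i \<le> \<theta>) \<and> (met A E = {i} \<longrightarrow> u i = 1))
    \<and> (\<Sum>i\<in>met A E. u i powr q) \<le> 1
    \<and> N j (proj E (comb A a)) \<le> w * (\<Sum>i\<in>met A E. \<bar>a i\<bar> * end_weight (met A E) i * u i)"
  (is "?P E j")
proof -
  note wpos = end_constant(1)[OF theta_pos theta_less w]
    and w1 = end_constant(2)[OF theta_pos theta_less w]
  have w0: "1 \<le> w" using w1 wpos theta_pos theta_less by (smt (verit) mult_left_le)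
  have fin: "finite (met A E)" for E using A by (simp add: met_def)
  \<comment> \<open>With fewer than two blocks met, the constant weight 1 serves at every level,
    since blocks have norm 1.\<close>
  have small: "?P E j" if card: "card (met A E) < 2" for E j
  proof (intro exI[of _ "\<lambda>_. 1"] conjI ballI)
    show "met A E \<noteq> {i} \<longrightarrow> 1 \<le> \<theta>" if "i \<in> met A E" for i
      using card that fin by (auto simp: less_Suc_eq numeral_2_eq_2 card_1_singleton_iff)
    show "(\<Sum>i\<in>met A E. 1 powr q) \<le> (1::real)" using card by simp
    have "N j (proj E (comb A a)) \<le> (\<Sum>i\<in>met A E. \<bar>a i\<bar> * N j (proj E (x i)))"
      by (rule N_proj_small[OF A card])
    also have "\<dots> \<le> (\<Sum>i\<in>met A E. \<bar>a i\<bar> * end_weight (met A E) i * 1)"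
    proof (rule sum_mono)
      fix i
      have "N j (proj E (x i)) \<le> end_weight (met A E) i"
        using N_proj_le[OF x_c00, of j E i] N_x_le[of j i] end_weight_bounds(1)[of "met A E" i] by linarith
      then show "\<bar>a i\<bar> * N j (proj E (x i)) \<le> \<bar>a i\<bar> * end_weight (met A E) i * 1"
        by (simp add: mult_left_mono)
    qed
    also have "\<dots> \<le> w * \<dots>"
    proof -
      have "0 \<le> (\<Sum>i\<in>met A E. \<bar>a i\<bar> * end_weight (met A E) i * 1)"
        using end_weight_bounds(1) by (intro sum_nonneg mult_nonneg_nonneg) (auto intro: order_trans[OF zero_le_one])
      then show ?thesis using w0 by (simp add: mult_left_le_one_le mult_le_cancel_right1)
    qed
    finally show "N j (proj E (comb A a)) \<le> w * (\<Sum>i\<in>met A E. \<bar>a i\<bar> * end_weight (met A E) i * 1)" .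
  qed auto
  show ?thesis
  proof (induction j arbitrary: E)
    case 0
    show ?case
    proof (cases "card (met A E) < 2")
      case True
      then show ?thesis by (rule small)
    next
      case False
      then have ns: "met A E \<noteq> {i}" for i by auto
      let ?y = "proj E (comb A a)"
      obtain s where s: "N 0 ?y = \<bar>?y s\<bar>"
        using N_0_attained[OF proj_in_c00[OF comb_in_c00[OF A]]] by blast
      show ?thesis
      proof (cases "\<exists>i\<in>A. s \<in> supp (x i) \<inter> E")
        case True
        then obtain i where i: "i \<in> A" "s \<in> supp (x i)" "s \<in> E" by blast
        then have im: "i \<in> met A E" by (auto simp: met_def)
        \<comment> \<open>Only the block containing the maximal coordinate gets weight. Several
          blocks are met, so the weight may not exceed \<open>\<theta>\<close>;
          \<open>1 \<le> w * \<theta>\<close> makes up for this.\<close>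
        let ?u = "\<lambda>j. if j = i then \<theta> else 0"
        have "N 0 ?y = \<bar>a i\<bar> * \<bar>x i s\<bar>" using s i comb_at[OF A i(1,2)] by (simp add: proj_def abs_mult)
        also have "\<dots> \<le> \<bar>a i\<bar> * 1"
          using N_0_ge[OF x_c00, of i s] N_x_le[of 0 i] by (intro mult_left_mono) auto
        also have "\<dots> \<le> \<bar>a i\<bar> * ((w * \<theta>) * end_weight (met A E) i)"
          using w1 end_weight_bounds(1)[of "met A E" i] mult_mono[of 1 "w * \<theta>" 1 "end_weight (met A E) i"]
          by (intro mult_left_mono) auto
        also have "\<dots> = w * (\<Sum>j\<in>met A E. \<bar>a j\<bar> * end_weight (met A E) j * ?u j)"
        proof -
          have "(\<Sum>j\<in>met A E. \<bar>a j\<bar> * end_weight (met A E) j * ?u j)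
              = (\<Sum>j\<in>met A E. if j = i then \<bar>a i\<bar> * end_weight (met A E) i * \<theta> else 0)"
            by (intro sum.cong) auto
          then show ?thesis using im fin by simp
        qed
        finally have le: "N 0 ?y \<le> w * (\<Sum>j\<in>met A E. \<bar>a j\<bar> * end_weight (met A E) j * ?u j)" .
        have "(\<Sum>j\<in>met A E. ?u j powr q) = (\<Sum>j\<in>met A E. if j = i then \<theta> powr q else 0)"
          using q by (intro sum.cong) auto
        also have "\<dots> \<le> 1" using im fin q d by simp
        finally show ?thesis using le ns theta_pos theta_less by (intro exI[of _ ?u]) auto
      next
        case False
        then have "?y s = 0" by (auto simp: proj_def intro!: comb_zero)
        then show ?thesis using s ns theta_pos q by (intro exI[of _ "\<lambda>_. 0"]) auto
      qed
    qed
  next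
    case (Suc j)
    show ?case
    proof (cases "card (met A E) < 2")
      case True
      then show ?thesis by (rule small)
    next
      case False
      then have ns: "met A E \<noteq> {i}" for i by auto
      let ?J = "met A E"
      let ?y = "proj E (comb A a)"
      have y: "?y \<in> c00 k" using A by (intro proj_in_c00 comb_in_c00)
      from y show ?thesis
      proof (rule N_Suc_cases[where j=j])
        assume "N (Suc j) ?y = N j ?y"
        then show ?thesis using Suc.IH[of E] by simp
      next
        fix m F assume F: "admissible k d m F"
          and eq: "N (Suc j) ?y = \<theta> * (\<Sum>l=1..m. N j (proj (F l) ?y))"
        define G where "G l = F l \<inter> E" for l
        define I where "I l = met A (G l)" for l
        have IJ: "I l \<subseteq> ?J" for l by (auto simp: I_def G_def met_def)
        have ord: "r \<le> r'" if "1 \<le> l" "l < l'" "l' \<le> m" "r \<in> I l" "r' \<in> I l'" for l l' r r'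
          using met_ordered[OF F that(1-3)] that(4,5) unfolding I_def G_def by blast
        have projG: "proj (F l) ?y = proj (G l) (comb A a)" for l
          by (auto simp: proj_def G_def)
        define Q where "Q l u \<longleftrightarrow>
          (\<forall>i\<in>I l. 0 \<le> u i \<and> u i \<le> 1 \<and> (I l \<noteq> {i} \<longrightarrow> u i \<le> \<theta>) \<and> (I l = {i} \<longrightarrow> u i = 1))
          \<and> (\<Sum>i\<in>I l. u i powr q) \<le> 1
          \<and> N j (proj (G l) (comb A a)) \<le> w * (\<Sum>i\<in>I l. \<bar>a i\<bar> * end_weight (I l) i * u i)" for l u
        have "\<forall>l. \<exists>u. Q l u" unfolding Q_def I_def using Suc.IH by blast
        then obtain U where U: "Q l (U l)" for l by metis
        define L where "L i = {l \<in> {1..m}. i \<in> I l}" for i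
        \<comment> \<open>Of the pieces meeting block \<open>i\<close> only the heaviest passes on
          its weight, one level deeper; \<open>w\<close> and \<open>end_weight\<close> cover the
          others.\<close>
        define u where "u i = (if L i = {} then 0 else \<theta> * Max ((\<lambda>l. U l i) ` L i))" for i
        \<comment> \<open>Pieces meeting only block \<open>i\<close> keep the norm of the restricted
          block: bounding each by 1 would lose their joint bound through
          \<open>N (Suc j) (x i)\<close>.\<close>
        define \<beta> where "\<beta> l i = (if I l = {i} then N j (proj (G l) (x i))
          else w * end_weight (I l) i * U l i)" for l i
        have finL: "finite (L i)" for i by (simp add: L_def)
        have Umax: "\<exists>l\<in>L i. u i = \<theta> * U l i" if "L i \<noteq> {}" for i
        proof -
          have "Max ((\<lambda>l. U l i) ` L i) \<in> (\<lambda>l. U l i) ` L i" using finL that by (intro Max_in) auto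
          then show ?thesis using that by (auto simp: u_def)
        qed
        have U01: "0 \<le> U l i" "U l i \<le> 1" if "l \<in> L i" for l i
          using U[of l] that by (auto simp: Q_def L_def)
        have u01: "0 \<le> u i \<and> u i \<le> \<theta>" for i
        proof (cases "L i = {}")
          case False
          then show ?thesis using Umax[OF False] U01 theta_pos by (auto intro: mult_left_le)
        qed (use theta_pos in \<open>simp add: u_def\<close>)
        have beta: "N j (proj (F l) ?y) \<le> (\<Sum>i\<in>I l. \<bar>a i\<bar> * \<beta> l i)" for l
        proof (cases "card (I l) < 2")
          case True
          have "I l = {i}" if "i \<in> I l" for i
            using True that fin[of "G l"] by (auto simp: I_def less_Suc_eq numeral_2_eq_2 card_1_singleton_iff)
          then have "(\<Sum>i\<in>I l. \<bar>a i\<bar> * N j (proj (G l) (x i))) = (\<Sum>i\<in>I l. \<bar>a i\<bar> * \<beta> l i)"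
            by (intro sum.cong) (auto simp: \<beta>_def)
          then show ?thesis
            using N_proj_small[OF A True[unfolded I_def], of j a] by (simp add: projG I_def)
        next
          case False
          then have "I l \<noteq> {i}" for i by auto
          then have "(\<Sum>i\<in>I l. \<bar>a i\<bar> * \<beta> l i) = w * (\<Sum>i\<in>I l. \<bar>a i\<bar> * end_weight (I l) i * U l i)"
            by (simp add: \<beta>_def sum_distrib_left algebra_simps)
          then show ?thesis using U[of l] by (simp add: projG Q_def)
        qed
        have swap: "(\<Sum>l=1..m. \<Sum>i\<in>I l. f l i) = (\<Sum>i\<in>?J. \<Sum>l\<in>L i. f l i)"
          for f :: "nat \<Rightarrow> nat \<Rightarrow> real"
        proof -
          have "(\<Sum>l=1..m. \<Sum>i\<in>I l. f l i) = (\<Sum>l=1..m. \<Sum>i\<in>?J. if i \<in> I l then f l i else 0)"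
          proof (rule sum.cong[OF refl])
            fix l
            show "(\<Sum>i\<in>I l. f l i) = (\<Sum>i\<in>?J. if i \<in> I l then f l i else 0)"
              using sum.inter_restrict[OF fin, of "f l" E "I l"] IJ[of l] by (simp add: Int_absorb1)
          qed
          also have "\<dots> = (\<Sum>i\<in>?J. \<Sum>l=1..m. if i \<in> I l then f l i else 0)" by (rule sum.swap)
          also have "\<dots> = (\<Sum>i\<in>?J. \<Sum>l\<in>L i. f l i)"
            by (rule sum.cong[OF refl]) (simp only: L_def sum.inter_filter[OF finite_atLeastAtMost])
          finally show ?thesis .
        qed
        have step: "\<theta> * (\<Sum>l\<in>L i. \<beta> l i) \<le> w * end_weight ?J i * u i" if i: "i \<in> ?J" for i
        proof (cases "L i = {}")
          case True
          then show ?thesis by (simp add: u_def)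
        next
          case False
          let ?X = "{l \<in> L i. I l = {i}}" and ?N = "{l \<in> L i. I l \<noteq> {i}}"
          \<comment> \<open>The pieces meeting only block \<open>i\<close> are part of the splitting
            of \<open>x i\<close> by \<open>F\<close>, so together they contribute at most its norm
            1.\<close>
          have "\<theta> * (\<Sum>l\<in>?X. N j (proj (G l) (x i))) \<le> of_bool (\<exists>l\<in>L i. I l = {i})"
          proof (cases "?X = {}")
            case True
            then show ?thesis by (simp only: sum.empty) simp
          next
            case False
            have "(\<Sum>l\<in>?X. N j (proj (G l) (x i))) \<le> (\<Sum>l\<in>?X. N j (proj (F l) (x i)))"
              using x_c00 by (intro sum_mono N_mono proj_in_c00) (auto simp: proj_def G_def)
            also have "\<dots> \<le> (\<Sum>l=1..m. N j (proj (F l) (x i)))"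
              using x_c00 by (intro sum_mono2 N_nonneg proj_in_c00) (auto simp: L_def)
            finally have "\<theta> * (\<Sum>l\<in>?X. N j (proj (G l) (x i))) \<le> \<theta> * (\<Sum>l=1..m. N j (proj (F l) (x i)))"
              using theta_pos by (intro mult_left_mono) auto
            also have "\<dots> \<le> N (Suc j) (x i)" by (rule N_Suc_ge[OF x_c00 F])
            also have "\<dots> \<le> 1" by (rule N_x_le)
            finally show ?thesis using False by auto
          qed
          moreover have "(\<Sum>l\<in>L i. \<beta> l i) = (\<Sum>l\<in>?X. N j (proj (G l) (x i))) + (\<Sum>l\<in>?N. w * end_weight (I l) i * U l i)"
          proof -
            have "(\<Sum>l\<in>L i. \<beta> l i) = (\<Sum>l\<in>?X. \<beta> l i) + (\<Sum>l\<in>?N. \<beta> l i)"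
              using finL by (subst sum.union_disjoint[symmetric]) (auto intro: sum.cong)
            then show ?thesis by (simp add: \<beta>_def)
          qed
          moreover have "\<theta> * (\<Sum>l\<in>?N. w * end_weight (I l) i * U l i)
              = (\<Sum>l\<in>?N. \<theta> * w * end_weight (I l) i * U l i)"
            by (simp add: sum_distrib_left mult.assoc)
          moreover have "(\<Sum>l\<in>?N. \<theta> * w * end_weight (I l) i * U l i) + of_bool (\<exists>l\<in>L i. I l = {i})
              \<le> w * end_weight ?J i * (\<theta> * Max ((\<lambda>l. U l i) ` L i))"
          proof (rule splitting_step[OF theta_pos theta_less w IJ _ i _ False])
            show "L i = {l \<in> {1..m}. i \<in> I l}" by (simp add: L_def)
            show "0 \<le> U l i \<and> U l i \<le> 1" if "l \<in> L i" for l using U01[OF that] by blast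
            show "U l i \<le> \<theta>" if "l \<in> L i" "I l \<noteq> {i}" for l
              using U[of l] that by (auto simp: Q_def L_def)
            show "U l i = 1" if "l \<in> L i" "I l = {i}" for l
              using U[of l] that by (auto simp: Q_def L_def)
          qed (rule ord)
          ultimately show ?thesis using False by (simp add: u_def distrib_left)
        qed
        have "N (Suc j) ?y \<le> \<theta> * (\<Sum>l=1..m. \<Sum>i\<in>I l. \<bar>a i\<bar> * \<beta> l i)"
          unfolding eq using theta_pos beta by (intro mult_left_mono sum_mono) auto
        also have "\<dots> = (\<Sum>i\<in>?J. \<bar>a i\<bar> * (\<theta> * (\<Sum>l\<in>L i. \<beta> l i)))"
          unfolding swap by (simp add: sum_distrib_left algebra_simps)
        also have "\<dots> \<le> (\<Sum>i\<in>?J. \<bar>a i\<bar> * (w * end_weight ?J i * u i))"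
          using step by (intro sum_mono mult_left_mono) auto
        also have "\<dots> = w * (\<Sum>i\<in>?J. \<bar>a i\<bar> * end_weight ?J i * u i)"
          by (simp add: sum_distrib_left algebra_simps)
        finally have "N (Suc j) ?y \<le> w * (\<Sum>i\<in>?J. \<bar>a i\<bar> * end_weight ?J i * u i)" .
        moreover have "(\<Sum>i\<in>?J. u i powr q) \<le> 1"
        proof -
          \<comment> \<open>Kraft's inequality passes up one level:
            \<open>\<theta> powr q = 1 / d\<close>, the largest term is bounded by the sum, and
            there are at most \<open>d\<close> pieces.\<close>
          have "u i powr q \<le> (\<Sum>l\<in>L i. U l i powr q / real d)" for i
          proof (cases "L i = {}")
            case True
            then show ?thesis using q by (simp add: u_def)
          next
            case False
            then obtain l where l: "l \<in> L i" "u i = \<theta> * U l i" using Umax by blast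
            then have "u i powr q = U l i powr q / real d"
              using theta_pos U01[of l i] q by (simp add: powr_mult)
            also have "\<dots> \<le> (\<Sum>l\<in>L i. U l i powr q / real d)"
              using l finL by (intro member_le_sum) auto
            finally show ?thesis .
          qed
          then have "(\<Sum>i\<in>?J. u i powr q) \<le> (\<Sum>i\<in>?J. \<Sum>l\<in>L i. U l i powr q / real d)"
            by (rule sum_mono)
          also have "\<dots> = (\<Sum>l=1..m. (\<Sum>i\<in>I l. U l i powr q) / real d)"
            by (simp add: swap[symmetric] sum_divide_distrib)
          also have "\<dots> \<le> (\<Sum>l=1..m. 1 / real d)"
            using U d by (intro sum_mono divide_right_mono) (auto simp: Q_def)
          also have "\<dots> \<le> 1" using F d by (simp add: admissible_def)
          finally show ?thesis .
        qed
        moreover have "u i \<le> 1" for i using u01[of i] theta_less by linarith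
        ultimately show ?thesis using u01 ns by (intro exI[of _ u]) simp
      qed
    qed
  qed
qed

text \<open>\<open>N_weights\<close> without restriction, followed by Hoelder's inequality. The
  constant is \<open>2 * w\<close>, with 2 the largest value of \<open>end_weight\<close>.\<close>

lemma T_comb_le:
  assumes A: "finite A" and pq: "1 < p" "1 < q" "1 / p + 1 / q = 1" and q: "\<theta> powr q = 1 / real d"
  shows "T (comb A a) \<le> 2 / (\<theta> * (1 - \<theta>)) * (\<Sum>i\<in>A. \<bar>a i\<bar> powr p) powr (1 / p)"
proof (rule T_le)
  fix j
  define w where "w = 1 / (\<theta> * (1 - \<theta>))"
  have w: "w * \<theta> * (1 - \<theta>) = 1" "0 < w" using theta_pos theta_less by (auto simp: w_def)
  let ?I = "met A UNIV"
  have fin: "finite ?I" using A by (simp add: met_def)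
  obtain u where u: "\<And>i. i \<in> ?I \<Longrightarrow> 0 \<le> u i" "(\<Sum>i\<in>?I. u i powr q) \<le> 1"
    and le: "N j (proj UNIV (comb A a)) \<le> w * (\<Sum>i\<in>?I. \<bar>a i\<bar> * end_weight ?I i * u i)"
    using N_weights[OF A _ q w(1), of UNIV j a] pq by auto
  have "proj UNIV (comb A a) = comb A a" by (simp add: proj_def)
  then have "N j (comb A a) \<le> w * (\<Sum>i\<in>?I. \<bar>a i\<bar> * end_weight ?I i * u i)" using le by simp
  also have "\<dots> \<le> w * (\<Sum>i\<in>?I. 2 * (\<bar>a i\<bar> * u i))"
  proof -
    have "\<bar>a i\<bar> * end_weight ?I i * u i \<le> 2 * (\<bar>a i\<bar> * u i)" if "i \<in> ?I" for i
      using mult_right_mono[OF end_weight_bounds(2)[of ?I i], of "\<bar>a i\<bar> * u i"] u(1)[OF that]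
      by (simp add: algebra_simps)
    then show ?thesis using w(2) by (intro mult_left_mono sum_mono) auto
  qed
  also have "\<dots> = 2 * w * (\<Sum>i\<in>?I. \<bar>a i\<bar> * u i)" by (simp add: sum_distrib_left algebra_simps)
  also have "\<dots> \<le> 2 * w * (\<Sum>i\<in>?I. \<bar>a i\<bar> powr p) powr (1 / p)"
    using w(2) u by (intro mult_left_mono Holder_sum[OF pq fin]) auto
  also have "\<dots> \<le> 2 * w * (\<Sum>i\<in>A. \<bar>a i\<bar> powr p) powr (1 / p)"
    using w(2) A pq by (intro mult_left_mono powr_mono2 sum_mono2 sum_nonneg) (auto simp: met_def)
  finally show "N j (comb A a) \<le> 2 / (\<theta> * (1 - \<theta>)) * (\<Sum>i\<in>A. \<bar>a i\<bar> powr p) powr (1 / p)"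
    by (simp add: w_def)
qed

end

section \<open>The lower estimate\<close>

locale T_max_blocks = T_blocks +
  fixes v :: "nat \<Rightarrow> nat list"
  assumes v_in: "\<And>i. v i \<in> omega_eq k"
    and v_le: "\<And>i. set_le {v i} (supp (x i))" and v_less: "\<And>i. set_less (supp (x i)) {v (Suc i)}"
    and supp_X_max: "\<And>i. supp (x i) \<subseteq> X_max k (v i)"
    and v_X_max: "\<And>i. v (Suc i) \<in> X_max k (v i)"
begin

lemma v_nonempty: "v i \<noteq> []"
  using v_in[of i] k by (auto simp: omega_eq_def)

text \<open>The nonempty support of \<open>x i\<close> separates \<open>v i\<close> from
  \<open>v (Suc i)\<close>, and a member of \<open>X_max k (v i)\<close> other than
  \<open>v i\<close> has a larger last entry.\<close>

lemma last_v_strict_mono: "strict_mono (\<lambda>i. last (v i))"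
  unfolding strict_mono_Suc_iff
proof
  fix i
  obtain s where "s \<in> supp (x i)" using v_le[of i] by (auto simp: set_le_def is_prec_min_def)
  then have "v i \<preceq> s" "s \<prec> v (Suc i)"
    using v_le v_less by (auto intro: set_le_singletonD set_less_singletonD)
  then have "v (Suc i) \<noteq> v i" using prec_eq_prec_trans by fastforce
  then show "last (v i) < last (v (Suc i))" by (rule X_max_last[OF v_in k v_X_max])
qed

lemma X_max_v_antimono: "i \<le> j \<Longrightarrow> X_max k (v j) \<subseteq> X_max k (v i)"
  by (induction j rule: dec_induct) (use X_max_trans[OF v_in v_X_max] in blast)+

lemma supp_prec_v:
  assumes "i \<le> j" "s \<in> supp (x i)"
  shows "s \<prec> v (Suc j)"
proof -
  have "s \<prec> v (Suc i)" using v_less assms(2) by (rule set_less_singletonD)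
  moreover have "v (Suc i) \<preceq> v (Suc j)"
    using assms(1) strict_mono_less[OF last_v_strict_mono, of "Suc i" "Suc j"] v_nonempty[of "Suc j"]
    by (cases "i = j") (auto simp: prec_eq_def intro: last_less_imp_prec)
  ultimately show ?thesis by (rule prec_prec_eq_trans)
qed

text \<open>The sequence \<open>v \<circ> b\<close> itself need not belong to an approximation. The gaps of length 3 leave
  room below \<open>v (b l)\<close> for a node whose last entry is that of \<open>v (b l - 1)\<close>, and the last entries of
  an approximation can be prescribed freely.\<close>

lemma admissible_blocks:
  fixes b g :: "nat \<Rightarrow> nat"
  assumes m: "1 \<le> m" "m \<le> d" and bg: "\<And>l. l \<in> {1..m} \<Longrightarrow> b l \<le> g l"
    and gap: "\<And>l. l \<in> {1..<m} \<Longrightarrow> g l + 3 \<le> b (Suc l)"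
  shows "admissible k d m (\<lambda>l. {s \<in> X_max k (v (b l)). s \<prec> v (Suc (g l))})"
proof -
  define E where "E l = {s \<in> X_max k (v (b l)). s \<prec> v (Suc (g l))}" for l
  have b_gap: "b i + 3 \<le> b j" if "1 \<le> i" "i < j" "j \<le> m" for i j
    using that(2,3)
  proof (induction j)
    case (Suc j)
    have "b j + 3 \<le> b (Suc j)" using gap[of j] bg[of j] that(1) Suc.prems by fastforce
    then show ?case using Suc by (cases "i = j") auto
  qed simp
  \<comment> \<open>For \<open>2 \<le> l \<le> m\<close> the gaps give \<open>b l \<ge> 3\<close>,
    so \<open>b l - 1\<close> is a genuine predecessor. For \<open>l = 1\<close> there may be none,
    and 0 is used.\<close>
  define M where "M l = (if l = 1 then 0 else last (v (b l - 1)))" for l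
  have last_less: "last (v i) < last (v j) \<longleftrightarrow> i < j" for i j
    using strict_mono_less[OF last_v_strict_mono] .
  have M: "M i < M j" if "1 \<le> i" "i < j" "j \<le> m" for i j
  proof (cases "i = 1")
    case True
    then show ?thesis using b_gap[OF that] last_less[of 0 "b j - 1"] that by (auto simp: M_def)
  next
    case False
    then show ?thesis using b_gap[OF that] b_gap[of 1 i] that by (auto simp: M_def last_less)
  qed
  obtain u where u: "u ` {1..m} \<in> AR_n k m" "\<forall>l\<in>{1..m}. u l \<in> omega_eq k \<and> last (u l) = M l"
    using ex_approximation_with_last[where N=M, OF k m(1) M] by blast
  have v_less_v: "v (b l) \<prec> v (Suc (g l))" if "l \<in> {1..m}" for l
    using bg[OF that] v_nonempty by (intro last_less_imp_prec) (auto simp: last_less)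
  have mem: "v (b l) \<in> E l" if "l \<in> {1..m}" for l
    using that v_less_v self_in_X_max[OF v_in] by (simp add: E_def)
  have E_omega: "E l \<subseteq> omega_eq k" for l
    using v_in max_tree_in_omega_eq by (auto simp: E_def X_max_def)
  have fin: "finite (E l)" for l
    by (rule finite_subset[OF _ finite_predecessors_omega_eq[of k "v (Suc (g l))"]])
       (use E_omega E_def in auto)
  have "E l \<in> AR k" if "l \<in> {1..m}" for l
    unfolding E_def
    by (rule initial_segment_in_AR[OF X_max_in_E_space[OF v_in] self_in_X_max[OF v_in] v_less_v[OF that]])
  moreover have "set_le {u l} (E l)" if l: "l \<in> {1..m}" for l
  proof -
    have "u l \<preceq> v (b l)"
    proof (cases "last (u l) < last (v (b l))")
      case True
      then show ?thesis using v_nonempty by (auto simp: prec_eq_def intro: last_less_imp_prec)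
    next
      case False
      \<comment> \<open>Only the first point can fail to have a smaller last entry; then both last
        entries are 0 and both nodes are the zero sequence.\<close>
      have "l = 1"
      proof (rule ccontr)
        assume "l \<noteq> 1"
        then show False using False u(2) l b_gap[of 1 l] by (auto simp: M_def last_less)
      qed
      then have "last (u l) = 0" "last (v (b l)) = 0" using False u(2) l by (auto simp: M_def)
      then have "u l = v (b l)" using omega_eq_last_zero v_in u(2) l by metis
      then show ?thesis by simp
    qed
    moreover have "is_prec_min (v (b l)) (E l)"
      using mem[OF l] by (intro is_prec_min_X_max[OF v_in k]) (auto simp: E_def)
    ultimately show ?thesis by (auto simp: set_le_def is_prec_max_def)
  qed
  moreover have "set_less (E l) {u (Suc l)}" if l: "l \<in> {1..<m}" for l
  proof -
    obtain s where s: "is_prec_max s (E l)" using ex_prec_max[OF fin, of l] mem[of l] l by auto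
    then have "s \<in> E l" by (simp add: is_prec_max_def)
    then have "s \<noteq> []" "s \<prec> v (Suc (g l))" using E_omega[of l] k by (auto simp: E_def omega_eq_def)
    then have "last s \<le> last (v (Suc (g l)))" by (intro prec_imp_last_le)
    \<comment> \<open>The gap gives \<open>g l + 1 < b (Suc l) - 1\<close>. An element before
      \<open>v (Suc (g l))\<close> may share its last entry, so strictness has to come from
      here.\<close>
    also have "\<dots> < last (v (b (Suc l) - 1))" using gap[OF l] by (auto simp: last_less)
    also have "\<dots> = last (u (Suc l))" using u(2) l by (auto simp: M_def)
    finally have "last s < last (u (Suc l))" .
    moreover have "u (Suc l) \<in> omega_eq k" using u(2) l by auto
    then have "u (Suc l) \<noteq> []" using k by (auto simp: omega_eq_def)
    ultimately have "s \<prec> u (Suc l)" by (rule last_less_imp_prec)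
    with s show ?thesis by (auto simp: set_less_def is_prec_min_def)
  qed
  moreover have "u ` {1..m} \<in> A_family k d" using u(1) m by (auto simp: A_family_def)
  ultimately show ?thesis using m unfolding admissible_def E_def[symmetric] by blast
qed

lemma T_comb_empty: "T (comb {} a) = 0"
proof -
  have "comb {} a = (\<lambda>s. 0 * x 0 s)" by (simp add: comb_def)
  then show ?thesis using T_scale[OF x_c00, of 0 0] by simp
qed

lemma T_comb_mono:
  assumes "finite B" "A \<subseteq> B"
  shows "T (comb A a) \<le> T (comb B a)"
proof (rule T_mono)
  have A: "finite A" using assms finite_subset by blast
  show "comb A a \<in> c00 k" "comb B a \<in> c00 k" using A assms by (auto intro: comb_in_c00)
  show "\<bar>comb A a s\<bar> \<le> \<bar>comb B a s\<bar>" for s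
  proof (cases "\<exists>i\<in>A. s \<in> supp (x i)")
    case True
    then obtain i where "i \<in> A" "s \<in> supp (x i)" by blast
    then show ?thesis using comb_at[OF A, of i s] comb_at[OF assms(1), of i s] assms(2) by auto
  next
    case False
    then show ?thesis by (subst comb_zero) auto
  qed
qed

text \<open>Provides the assumption \<open>split\<close> of \<open>lp_lower_bound\<close>. Since
  \<open>c\<close> is monotone its classes are successive, and the spacing of \<open>B\<close> makes
  the sets covering them admissible.\<close>

lemma T_comb_split:
  assumes B: "finite B" and spaced: "\<And>i j. i \<in> B \<Longrightarrow> j \<in> B \<Longrightarrow> i < j \<Longrightarrow> i + 3 \<le> j"
    and c: "c ` B \<subseteq> {..<d}" "mono_on B c"
  shows "\<theta> * (\<Sum>e<d. T (comb {i \<in> B. c i = e} a)) \<le> T (comb B a)"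
proof (cases "B = {}")
  case True
  then show ?thesis by (simp add: T_comb_empty)
next
  case False
  define C where "C = c ` B"
  \<comment> \<open>The values of \<open>c\<close> that occur, in increasing order. Sets of an
    admissible sequence are nonempty, so empty classes are dropped.\<close>
  define es where "es = sorted_list_of_set C"
  define m where "m = length es"
  have C: "finite C" "C \<noteq> {}" using B False by (auto simp: C_def)
  have m: "m = card C" by (simp add: m_def es_def)
  have "1 \<le> m" using C by (simp add: m Suc_le_eq card_gt_0_iff)
  have "m \<le> d" using card_mono[OF _ c(1)] by (simp add: m C_def)
  define P where "P l = {i \<in> B. c i = es ! (l - 1)}" for l
  have P_fin: "finite (P l)" for l using B by (simp add: P_def)
  have P_ne: "P l \<noteq> {}" if "l \<in> {1..m}" for l
  proof -
    have "es ! (l - 1) \<in> set es" using that by (intro nth_mem) (auto simp: m_def)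
    then show ?thesis using C by (auto simp: es_def C_def P_def)
  qed
  define b g where "b l = Min (P l)" and "g l = Max (P l)" for l
  have bg: "b l \<in> P l" "g l \<in> P l" if "l \<in> {1..m}" for l
    using P_fin P_ne[OF that] by (auto simp: b_def g_def)
  have P_between: "b l \<le> i" "i \<le> g l" if "i \<in> P l" for i l
    using P_fin that by (auto simp: b_def g_def)
  define E where "E l = {s \<in> X_max k (v (b l)). s \<prec> v (Suc (g l))}" for l
  have adm: "admissible k d m E"
    unfolding E_def
  proof (rule admissible_blocks[OF \<open>1 \<le> m\<close> \<open>m \<le> d\<close>])
    show "b l \<le> g l" if "l \<in> {1..m}" for l using P_between[OF bg(1)[OF that]] by simp
    show "g l + 3 \<le> b (Suc l)" if l: "l \<in> {1..<m}" for l
    proof (rule spaced)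
      have gl: "g l \<in> P l" and bl: "b (Suc l) \<in> P (Suc l)" using bg l by auto
      then show "g l \<in> B" "b (Suc l) \<in> B" by (auto simp: P_def)
      have "es ! (l - 1) < es ! l"
        using l by (intro sorted_wrt_nth_less[of "(<)"]) (auto simp: es_def m_def)
      then have "c (g l) < c (b (Suc l))" using gl bl by (simp add: P_def)
      then show "g l < b (Suc l)"
        using mono_onD[OF c(2) \<open>b (Suc l) \<in> B\<close> \<open>g l \<in> B\<close>] by (meson not_le)
    qed
  qed
  \<comment> \<open>\<open>E l\<close> contains the supports of all blocks in \<open>P l\<close>;
    whatever else of the combination it meets can only increase the norm.\<close>
  have "T (comb (P l) a) \<le> T (proj (E l) (comb B a))" for l
  proof (rule T_mono)
    show "comb (P l) a \<in> c00 k" "proj (E l) (comb B a) \<in> c00 k"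
      using P_fin B by (auto intro: comb_in_c00 proj_in_c00)
    show "\<bar>comb (P l) a s\<bar> \<le> \<bar>proj (E l) (comb B a) s\<bar>" for s
    proof (cases "\<exists>i\<in>P l. s \<in> supp (x i)")
      case True
      then obtain i where i: "i \<in> P l" "s \<in> supp (x i)" by blast
      then have "i \<in> B" by (simp add: P_def)
      have "s \<in> E l"
        using supp_prec_v[OF P_between(2)[OF i(1)] i(2)] supp_X_max i(2)
          X_max_v_antimono[OF P_between(1)[OF i(1)]] by (auto simp: E_def)
      then show ?thesis
        using comb_at[OF P_fin i] comb_at[OF B \<open>i \<in> B\<close> i(2)] by (simp add: proj_def)
    next
      case False
      then show ?thesis by (subst comb_zero) auto
    qed
  qed
  then have "\<theta> * (\<Sum>l=1..m. T (comb (P l) a)) \<le> \<theta> * (\<Sum>l=1..m. T (proj (E l) (comb B a)))"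
    using theta_pos by (intro mult_left_mono sum_mono) auto
  also have "\<dots> \<le> T (comb B a)" by (rule T_admissible[OF comb_in_c00[OF B] adm])
  finally have le: "\<theta> * (\<Sum>l=1..m. T (comb (P l) a)) \<le> T (comb B a)" .
  have "(\<Sum>e<d. T (comb {i \<in> B. c i = e} a)) = (\<Sum>e\<in>C. T (comb {i \<in> B. c i = e} a))"
  proof (rule sum.mono_neutral_right)
    show "\<forall>e\<in>{..<d} - C. T (comb {i \<in> B. c i = e} a) = 0"
    proof
      fix e assume "e \<in> {..<d} - C"
      then have "{i \<in> B. c i = e} = {}" by (auto simp: C_def)
      then show "T (comb {i \<in> B. c i = e} a) = 0" by (simp only: T_comb_empty)
    qed
  qed (use c(1) in \<open>auto simp: C_def\<close>)
  also have "\<dots> = (\<Sum>l<m. T (comb {i \<in> B. c i = es ! l} a))"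
  proof (rule sum.reindex_bij_betw[symmetric])
    show "bij_betw ((!) es) {..<m} C"
      by (rule bij_betw_nth) (use C in \<open>simp_all add: es_def m_def\<close>)
  qed
  also have "\<dots> = (\<Sum>l=1..m. T (comb (P l) a))"
    unfolding P_def
    by (rule sum.reindex_bij_witness[of _ "\<lambda>l. l - 1" Suc]) auto
  finally show ?thesis using le by simp
qed

text \<open>Residue classes modulo 3 have the required gaps. \<open>lp_lower_bound\<close> applies
  to each class, and adding the three p-th powers costs the factor
  \<open>3 powr (1 / p)\<close>.\<close>

lemma T_comb_ge:
  assumes d2: "2 \<le> d" and pq: "1 < p" "1 < q" "1 / p + 1 / q = 1" and q: "\<theta> powr q = 1 / real d"
  shows "(\<Sum>i<n. \<bar>a i\<bar> powr p) powr (1 / p)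
    \<le> 3 powr (1 / p) * (2 * real d) powr (1 / q) * T (comb {..<n} a)"
proof -
  \<comment> \<open>Vanishing coefficients are left out because \<open>lp_lower_bound\<close>
    assigns every index an interval of positive length.\<close>
  define A where "A r = {i \<in> {..<n}. a i \<noteq> 0 \<and> i mod 3 = r}" for r :: nat
  define t where "t = (2 * real d) powr (1 / q) * T (comb {..<n} a)"
  have fin: "finite (A r)" for r by (simp add: A_def)
  have t0: "0 \<le> t" using T_nonneg[OF comb_in_c00] by (simp add: t_def)
  have piece: "(\<Sum>i\<in>A r. \<bar>a i\<bar> powr p) \<le> t powr p" for r
  proof -
    have spaced: "i + 3 \<le> j" if "i \<in> A r" "j \<in> A r" "i < j" for i j
    proof -
      have "i mod 3 = j mod 3" using that by (simp add: A_def)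
      then have "3 dvd j - i" using \<open>i < j\<close> by (metis less_imp_le mod_eq_dvd_iff_nat)
      then show ?thesis using \<open>i < j\<close> dvd_imp_le[of 3 "j - i"] by linarith
    qed
    have "(\<Sum>i\<in>A r. \<bar>a i\<bar> powr p) powr (1 / p) \<le> (2 * real d) powr (1 / q) * T (comb (A r) a)"
    proof (rule lp_lower_bound[where \<Phi>="\<lambda>B. T (comb B a)", OF d2 fin theta_pos pq q T_comb_empty])
      show "\<bar>a i\<bar> \<le> T (comb {i} a)" for i
        using T_scale[OF x_c00, of "a i" i] T_x by (simp add: comb_def)
      show "a i \<noteq> 0" if "i \<in> A r" for i using that by (simp add: A_def)
      show "\<theta> * (\<Sum>e<d. T (comb {i \<in> B. c i = e} a)) \<le> T (comb B a)"
        if "B \<subseteq> A r" "c ` B \<subseteq> {..<d}" "mono_on B c" for B c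
      proof (rule T_comb_split)
        show "finite B" using that(1) fin by (rule finite_subset)
        show "i + 3 \<le> j" if "i \<in> B" "j \<in> B" "i < j" for i j
          using that \<open>B \<subseteq> A r\<close> by (intro spaced) auto
      qed (use that in auto)
    qed
    also have "\<dots> \<le> t"
      unfolding t_def by (intro mult_left_mono T_comb_mono) (auto simp: A_def)
    finally have "((\<Sum>i\<in>A r. \<bar>a i\<bar> powr p) powr (1 / p)) powr p \<le> t powr p"
      using pq by (intro powr_mono2) auto
    then show ?thesis using pq by (simp add: powr_powr sum_nonneg)
  qed
  have "(\<Sum>i<n. \<bar>a i\<bar> powr p) = (\<Sum>i | i \<in> {..<n} \<and> a i \<noteq> 0. \<bar>a i\<bar> powr p)"
    by (intro sum.mono_neutral_right) auto
  also have "\<dots> = (\<Sum>r<3. \<Sum>i\<in>A r. \<bar>a i\<bar> powr p)"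
  proof -
    have "(\<lambda>i. i mod 3) ` {i \<in> {..<n}. a i \<noteq> 0} \<subseteq> {..<3}" by auto
    from sum.group[OF _ _ this, of "\<lambda>i. \<bar>a i\<bar> powr p"] show ?thesis
      by (simp add: A_def conj_assoc)
  qed
  also have "\<dots> \<le> (\<Sum>r<3::nat. t powr p)" by (rule sum_mono[OF piece])
  also have "\<dots> = 3 * t powr p" by simp
  finally have "(\<Sum>i<n. \<bar>a i\<bar> powr p) powr (1 / p) \<le> (3 * t powr p) powr (1 / p)"
    using pq by (intro powr_mono2 sum_nonneg) auto
  also have "\<dots> = 3 powr (1 / p) * t" using pq t0 by (simp add: powr_mult powr_powr)
  finally show ?thesis by (simp add: t_def)
qed

end

section \<open>The canonical basis and the equivalence\<close>

lemma lp_norm_lincomb_lp_basis: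
  "lp_norm p (lincomb n a lp_basis) = (\<Sum>i<n. \<bar>a i\<bar> powr p) powr (1 / p)"
proof -
  have b: "lincomb n a lp_basis j = (if j < n then a j else 0)" for j
    by (simp add: lincomb_def lp_basis_def if_distrib[of "\<lambda>z. _ * z"] cong: if_cong)
  have "(\<Sum>j. \<bar>lincomb n a lp_basis j\<bar> powr p) = (\<Sum>j<n. \<bar>lincomb n a lp_basis j\<bar> powr p)"
    by (rule suminf_finite) (auto simp: b)
  then show ?thesis by (simp add: lp_norm_def b)
qed

lemma block_sequence_prec:
  assumes "block_sequence k x" "i < j" "s \<in> supp (x i)" "t \<in> supp (x j)"
  shows "s \<prec> t"
  using assms(2,4)
proof (induction j arbitrary: t)
  case (Suc j)
  obtain r where r: "r \<in> supp (x j)" using assms(1) by (auto simp: block_sequence_def)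
  have "r \<prec> t" using assms(1) Suc.prems r by (auto simp: block_sequence_def intro: set_lessD)
  show ?case
  proof (cases "i = j")
    case True
    then show ?thesis using assms(1,3) Suc.prems by (auto simp: block_sequence_def intro: set_lessD)
  next
    case False
    then have "s \<prec> r" using Suc r by simp
    with \<open>r \<prec> t\<close> show ?thesis by (rule prec_trans[rotated])
  qed
qed simp

theorem theorem9p3:
  fixes k d :: nat and \<theta> p :: real
    and x :: "nat \<Rightarrow> nat list \<Rightarrow> real" and v :: "nat \<Rightarrow> nat list"
  assumes "k \<ge> 2" and "d \<ge> 1"
    and "0 < \<theta>" and "\<theta> < 1" and "real d * \<theta> > 1"
    and "1 < p" and "real d * \<theta> = real d powr (1 / p)"
    and "block_sequence k x" and "\<forall>i. T_norm k d \<theta> (x i) = 1"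
    and "\<forall>i. v i \<in> omega_eq k"
    and "\<forall>i. set_le {v i} (supp (x i)) \<and> set_less (supp (x i)) {v (Suc i)}"
    and "\<forall>i. supp (x i) \<subseteq> X_max k (v i) \<and> v (Suc i) \<in> X_max k (v i)"
  shows "equivalent_sequences (T_norm k d \<theta>) x (lp_norm p) lp_basis"
proof -
  interpret T_max_blocks k d \<theta> x v
    using assms block_sequence_prec[OF assms(8)]
    by unfold_locales (auto simp: block_sequence_def)
  \<comment> \<open>The exponent conjugate to \<open>p\<close>; in terms of it the equation for
    \<open>p\<close> reads \<open>\<theta> = d powr (- (1 / q))\<close>.\<close>
  define q where "q = p / (p - 1)"
  have pq: "1 < p" "1 < q" "1 / p + 1 / q = 1"
    using assms(6) by (auto simp: q_def field_simps)
  have d2: "2 \<le> d"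
  proof (rule ccontr)
    assume "\<not> 2 \<le> d"
    then have "d = 1" using assms(2) by simp
    then show False using assms(4,5) by simp
  qed
  have "\<theta> = real d powr (1 / p) / real d powr 1" using assms(7) d2 by (simp add: field_simps)
  also have "\<dots> = real d powr (1 / p - 1)" by (rule powr_diff[symmetric])
  also have "1 / p - 1 = - (1 / q)" using pq(3) by simp
  finally have "\<theta> powr q = real d powr (- (1 / q) * q)" by (simp only: powr_powr)
  then have q: "\<theta> powr q = 1 / real d" using pq d2 by (simp add: powr_minus_divide)
  define K1 where "K1 = 2 / (\<theta> * (1 - \<theta>))"
  define K2 where "K2 = 3 powr (1 / p) * (2 * real d) powr (1 / q)"
  have K: "0 < K1" "0 < K2" using assms(3,4) d2 by (auto simp: K1_def K2_def)
  show ?thesis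
    unfolding equivalent_sequences_def lp_norm_lincomb_lp_basis lincomb_eq_comb
  proof (intro exI[of _ "K1 + K2"] conjI allI)
    fix n :: nat and a
    let ?S = "(\<Sum>i<n. \<bar>a i\<bar> powr p) powr (1 / p)"
    have "T (comb {..<n} a) \<le> K1 * ?S" unfolding K1_def by (rule T_comb_le[OF _ pq q]) simp
    also have "\<dots> \<le> (K1 + K2) * ?S" using K by (intro mult_right_mono) auto
    finally show "T (comb {..<n} a) \<le> (K1 + K2) * ?S" .
    have "?S \<le> K2 * T (comb {..<n} a)" unfolding K2_def by (rule T_comb_ge[OF d2 pq q])
    also have "\<dots> \<le> (K1 + K2) * T (comb {..<n} a)"
      using K T_nonneg[OF comb_in_c00] by (intro mult_right_mono) auto
    finally show "?S \<le> (K1 + K2) * T (comb {..<n} a)" .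
  qed (use K in simp)
qed

end
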